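(* Let $T$ be a complete first-order theory which is NIP, let $M$ be a model of $T$, and let $G=G(M)$ be a group definable in $M$ (with parameters from $M$). Then every minimal proximal definable $G$-flow is strongly proximal. In particular, $\Pi^{\mathrm{def}}(G)=\Pi^{\mathrm{def}}_{\mathrm{s}}(G)$, i.e. the universal minimal proximal definable $G$-flow coincides with the universal minimal strongly proximal definable $G$-flow.
   Context: "Definable" means definable in $M$ with parameters from $M$. A $G$-flow is a nonempty compact Hausdorff space $X$ with an action of $G$ on $X$ by homeomorphisms. It is a definable $G$-flow if for every $x\in X$ the orbit map $f_x:G\to X$, $g\mapsto gx$, is definable in the following sense: for any disjoint closed subsets $C_1,C_2\subseteq X$ there is a definable subset $D\subseteq G$ separating $f_x^{-1}(C_1)$ and $f_x^{-1}(C_2)$ (i.e. $D$ contains one and is disjoint from the other). A subflow is a closed $G$-invariant subset; $X$ is minimal if it has no nonempty proper subflow. $X$ is proximal if for all $x,y\in X$ there is a net $(g_i)_i$ in $G$ with $\lim_i g_ix=\lim_i g_iy$. $\mathrm{Prob}(X)$ is the space of regular Borel probability measures on $X$ with the weak-* topology (as a subspace of the dual of $C(X)$, the continuous functions $X\to\mathbb{R}$), with the induced $G$-action. $X$ is strongly proximal if for every $\mu\in\mathrm{Prob}(X)$ the weak-* closure of the orbit $G\mu$ contains a Dirac measure. $\Pi^{\mathrm{def}}(G)$ (resp. $\Pi^{\mathrm{def}}_{\mathrm{s}}(G)$) denotes the universal minimal proximal (resp. strongly proximal) definable $G$-flow: a minimal proximal (resp. strongly proximal) definable $G$-flow which admits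 a continuous surjective $G$-equivariant map onto every minimal proximal (resp. strongly proximal) definable $G$-flow. Both exist and are unique up to isomorphism of $G$-flows (equivariant homeomorphism). *)

theory Defs
  imports "HOL-Probability.Probability" "HOL-Algebra.Group_Action"
begin

record ('f, 'r) language =
  funs :: "'f set"
  rels :: "'r set"
  fun_arity :: "'f \<Rightarrow> nat"
  rel_arity :: "'r \<Rightarrow> nat"

datatype 'f tm = Var nat | Fn 'f "'f tm list"

datatype ('f, 'r) fm =
    Eq "'f tm" "'f tm"
  | Rl 'r "'f tm list"
  | Neg "('f, 'r) fm"
  | Conj "('f, 'r) fm" "('f, 'r) fm"
  | Ex nat "('f, 'r) fm"

fun fv_tm :: "'f tm \<Rightarrow> nat set" where
  "fv_tm (Var i) = {i}"
| "fv_tm (Fn f ts) = (\<Union>t \<in> set ts. fv_tm t)"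

primrec fv :: "('f, 'r) fm \<Rightarrow> nat set" where
  "fv (Eq s t) = fv_tm s \<union> fv_tm t"
| "fv (Rl r ts) = (\<Union>t \<in> set ts. fv_tm t)"
| "fv (Neg \<phi>) = fv \<phi>"
| "fv (Conj \<phi> \<psi>) = fv \<phi> \<union> fv \<psi>"
| "fv (Ex i \<phi>) = fv \<phi> - {i}"

fun wf_tm :: "('f, 'r) language \<Rightarrow> 'f tm \<Rightarrow> bool" where
  "wf_tm L (Var i) \<longleftrightarrow> True"
| "wf_tm L (Fn f ts) \<longleftrightarrow>
    f \<in> funs L \<and> length ts = fun_arity L f \<and> (\<forall>t \<in> set ts. wf_tm L t)"

primrec wf_fm :: "('f, 'r) language \<Rightarrow> ('f, 'r) fm \<Rightarrow> bool" where
  "wf_fm L (Eq s t) \<longleftrightarrow> wf_tm L s \<and> wf_tm L t"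
| "wf_fm L (Rl r ts) \<longleftrightarrow>
    r \<in> rels L \<and> length ts = rel_arity L r \<and> (\<forall>t \<in> set ts. wf_tm L t)"
| "wf_fm L (Neg \<phi>) \<longleftrightarrow> wf_fm L \<phi>"
| "wf_fm L (Conj \<phi> \<psi>) \<longleftrightarrow> wf_fm L \<phi> \<and> wf_fm L \<psi>"
| "wf_fm L (Ex i \<phi>) \<longleftrightarrow> wf_fm L \<phi>"

record ('f, 'r, 'a) fo_structure =
  univ :: "'a set"
  fun_int :: "'f \<Rightarrow> 'a list \<Rightarrow> 'a"
  rel_int :: "'r \<Rightarrow> 'a list \<Rightarrow> bool"

definition tuples :: "('f, 'r, 'a) fo_structure \<Rightarrow> nat \<Rightarrow> 'a list set" where
  "tuples M n = {xs. length xs = n \<and> set xs \<subseteq> univ M}"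

definition is_structure :: "('f, 'r) language \<Rightarrow> ('f, 'r, 'a) fo_structure \<Rightarrow> bool" where
  "is_structure L M \<longleftrightarrow> univ M \<noteq> {} \<and>
     (\<forall>f \<in> funs L. \<forall>xs \<in> tuples M (fun_arity L f). fun_int M f xs \<in> univ M)"

primrec eval_tm :: "('f, 'r, 'a) fo_structure \<Rightarrow> (nat \<Rightarrow> 'a) \<Rightarrow> 'f tm \<Rightarrow> 'a" where
  "eval_tm M e (Var i) = e i"
| "eval_tm M e (Fn f ts) = fun_int M f (map (eval_tm M e) ts)"

primrec sat :: "('f, 'r, 'a) fo_structure \<Rightarrow> (nat \<Rightarrow> 'a) \<Rightarrow> ('f, 'r) fm \<Rightarrow> bool" where
  "sat M e (Eq s t) \<longleftrightarrow> eval_tm M e s = eval_tm M e t"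
| "sat M e (Rl r ts) \<longleftrightarrow> rel_int M r (map (eval_tm M e) ts)"
| "sat M e (Neg \<phi>) \<longleftrightarrow> \<not> sat M e \<phi>"
| "sat M e (Conj \<phi> \<psi>) \<longleftrightarrow> sat M e \<phi> \<and> sat M e \<psi>"
| "sat M e (Ex i \<phi>) \<longleftrightarrow> (\<exists>a \<in> univ M. sat M (e(i := a)) \<phi>)"

definition sentence :: "('f, 'r) language \<Rightarrow> ('f, 'r) fm \<Rightarrow> bool" where
  "sentence L \<phi> \<longleftrightarrow> wf_fm L \<phi> \<and> fv \<phi> = {}"

definition holds :: "('f, 'r, 'a) fo_structure \<Rightarrow> ('f, 'r) fm \<Rightarrow> bool" where
  "holds M \<phi> \<longleftrightarrow> (\<forall>e. range e \<subseteq> univ M \<longrightarrow> sat M e \<phi>)"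

definition is_model ::
  "('f, 'r) language \<Rightarrow> ('f, 'r) fm set \<Rightarrow> ('f, 'r, 'a) fo_structure \<Rightarrow> bool" where
  "is_model L T M \<longleftrightarrow> is_structure L M \<and> (\<forall>\<phi> \<in> T. holds M \<phi>)"

text \<open>
  A definition cannot quantify over models of all types. Quantifiers over the class of all models
  of a theory are rendered below by models whose universe is a subset of the type of formulas. That
  type is infinite and at least as large as the language, so by Loewenheim-Skolem every model is
  elementarily equivalent to such a model; the properties quantified over (truth of a sentence,
  shattering of some set of \<open>n\<close> tuples) are invariant under elementary equivalence.
\<close>

type_synonym ('f, 'r) small_structure = "('f, 'r, ('f, 'r) fm) fo_structure"

definition entails :: "('f, 'r) language \<Rightarrow> ('f, 'r) fm set \<Rightarrow> ('f, 'r) fm \<Rightarrow> bool" where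
  "entails L T \<phi> \<longleftrightarrow> (\<forall>N :: ('f, 'r) small_structure. is_model L T N \<longrightarrow> holds N \<phi>)"

definition complete_theory :: "('f, 'r) language \<Rightarrow> ('f, 'r) fm set \<Rightarrow> bool" where
  "complete_theory L T \<longleftrightarrow>
     (\<forall>\<phi> \<in> T. sentence L \<phi>) \<and>
     (\<exists>N :: ('f, 'r) small_structure. is_model L T N) \<and>
     (\<forall>\<phi>. sentence L \<phi> \<longrightarrow> entails L T \<phi> \<or> entails L T (Neg \<phi>))"

text \<open>
  A formula whose free variables are among \<open>0, \<dots>, p + q - 1\<close> is read as \<open>\<phi>(x; y)\<close> with
  \<open>x\<close> the first \<open>p\<close> variables and \<open>y\<close> the next \<open>q\<close>. The assignment \<open>(!) (a @ b)\<close> substitutes the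
  tuples \<open>a\<close> and \<open>b\<close>; its values at indices beyond the length of the list are never used.
\<close>

definition shatters ::
  "('f, 'r, 'a) fo_structure \<Rightarrow> ('f, 'r) fm \<Rightarrow> nat \<Rightarrow> 'a list set \<Rightarrow> bool" where
  "shatters M \<phi> q A \<longleftrightarrow>
     (\<forall>B \<subseteq> A. \<exists>b \<in> tuples M q. \<forall>a \<in> A. sat M ((!) (a @ b)) \<phi> \<longleftrightarrow> a \<in> B)"

definition has_IP ::
  "('f, 'r) language \<Rightarrow> ('f, 'r) fm set \<Rightarrow> ('f, 'r) fm \<Rightarrow> nat \<Rightarrow> nat \<Rightarrow> bool" where
  "has_IP L T \<phi> p q \<longleftrightarrow>
     (\<forall>n. \<exists>N :: ('f, 'r) small_structure. is_model L T N \<and>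
        (\<exists>A \<subseteq> tuples N p. finite A \<and> card A = n \<and> shatters N \<phi> q A))"

definition NIP_theory :: "('f, 'r) language \<Rightarrow> ('f, 'r) fm set \<Rightarrow> bool" where
  "NIP_theory L T \<longleftrightarrow>
     (\<forall>\<phi> p q. wf_fm L \<phi> \<and> fv \<phi> \<subseteq> {..<p + q} \<longrightarrow> \<not> has_IP L T \<phi> p q)"

text \<open>The tuple \<open>b\<close> consists of the parameters.\<close>

definition definable_set ::
  "('f, 'r) language \<Rightarrow> ('f, 'r, 'a) fo_structure \<Rightarrow> nat \<Rightarrow> 'a list set \<Rightarrow> bool" where
  "definable_set L M n D \<longleftrightarrow>
     (\<exists>\<phi> q. \<exists>b \<in> tuples M q. wf_fm L \<phi> \<and> fv \<phi> \<subseteq> {..<n + q} \<and>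
        D = {a \<in> tuples M n. sat M ((!) (a @ b)) \<phi>})"

definition definable_group ::
  "('f, 'r) language \<Rightarrow> ('f, 'r, 'a) fo_structure \<Rightarrow> nat \<Rightarrow> 'a list monoid \<Rightarrow> bool" where
  "definable_group L M n G \<longleftrightarrow> group G \<and> definable_set L M n (carrier G) \<and>
     definable_set L M (3 * n) {a @ b @ (a \<otimes>\<^bsub>G\<^esub> b) | a b. a \<in> carrier G \<and> b \<in> carrier G}"

definition flow :: "('g, 'm) monoid_scheme \<Rightarrow> 'x topology \<Rightarrow> ('g \<Rightarrow> 'x \<Rightarrow> 'x) \<Rightarrow> bool" where
  "flow G X \<alpha> \<longleftrightarrow> topspace X \<noteq> {} \<and> compact_space X \<and> Hausdorff_space X \<and>
     group_action G (topspace X) \<alpha> \<and> (\<forall>g \<in> carrier G. homeomorphic_map X X (\<alpha> g))"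

definition separates :: "'g set \<Rightarrow> 'g set \<Rightarrow> 'g set \<Rightarrow> bool" where
  "separates D A B \<longleftrightarrow> A \<subseteq> D \<and> D \<inter> B = {} \<or> B \<subseteq> D \<and> D \<inter> A = {}"

definition definable_flow ::
  "('f, 'r) language \<Rightarrow> ('f, 'r, 'a) fo_structure \<Rightarrow> nat \<Rightarrow> 'a list monoid \<Rightarrow>
   'x topology \<Rightarrow> ('a list \<Rightarrow> 'x \<Rightarrow> 'x) \<Rightarrow> bool" where
  "definable_flow L M n G X \<alpha> \<longleftrightarrow> flow G X \<alpha> \<and>
     (\<forall>x \<in> topspace X. \<forall>C1 C2. closedin X C1 \<and> closedin X C2 \<and> C1 \<inter> C2 = {} \<longrightarrow>
        (\<exists>D \<subseteq> carrier G. definable_set L M n D \<and>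
           separates D {g \<in> carrier G. \<alpha> g x \<in> C1} {g \<in> carrier G. \<alpha> g x \<in> C2}))"

definition subflow ::
  "('g, 'm) monoid_scheme \<Rightarrow> 'x topology \<Rightarrow> ('g \<Rightarrow> 'x \<Rightarrow> 'x) \<Rightarrow> 'x set \<Rightarrow> bool" where
  "subflow G X \<alpha> Y \<longleftrightarrow> closedin X Y \<and> (\<forall>g \<in> carrier G. \<forall>y \<in> Y. \<alpha> g y \<in> Y)"

definition minimal ::
  "('g, 'm) monoid_scheme \<Rightarrow> 'x topology \<Rightarrow> ('g \<Rightarrow> 'x \<Rightarrow> 'x) \<Rightarrow> bool" where
  "minimal G X \<alpha> \<longleftrightarrow> (\<forall>Y. subflow G X \<alpha> Y \<and> Y \<noteq> {} \<longrightarrow> Y = topspace X)"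

text \<open>
  A net in \<open>G\<close> enters only through the filter on \<open>G\<close> generated by its tails, and every proper filter
  containing \<open>carrier G\<close> arises in this way.
\<close>

definition proximal ::
  "('g, 'm) monoid_scheme \<Rightarrow> 'x topology \<Rightarrow> ('g \<Rightarrow> 'x \<Rightarrow> 'x) \<Rightarrow> bool" where
  "proximal G X \<alpha> \<longleftrightarrow>
     (\<forall>x \<in> topspace X. \<forall>y \<in> topspace X. \<exists>F z. F \<noteq> bot \<and> F \<le> principal (carrier G) \<and>
        limitin X (\<lambda>g. \<alpha> g x) z F \<and> limitin X (\<lambda>g. \<alpha> g y) z F)"

definition borel_measure_of :: "'x topology \<Rightarrow> 'x measure" where
  "borel_measure_of X = sigma (topspace X) {U. openin X U}"

definition Prob :: "'x topology \<Rightarrow> 'x measure set" where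
  "Prob X = {\<mu>. prob_space \<mu> \<and> sets \<mu> = sets (borel_measure_of X) \<and>
     (\<forall>A \<in> sets \<mu>.
        emeasure \<mu> A = (SUP K \<in> {K. K \<subseteq> A \<and> compactin X K}. emeasure \<mu> K) \<and>
        emeasure \<mu> A = (INF U \<in> {U. A \<subseteq> U \<and> openin X U}. emeasure \<mu> U))}"

definition cont_funs :: "'x topology \<Rightarrow> ('x \<Rightarrow> real) set" where
  "cont_funs X = {f. continuous_map X euclideanreal f}"

text \<open>
  The weak-* topology: the topology induced on \<open>Prob X\<close> by viewing \<open>\<mu>\<close> as the functional
  \<open>f \<mapsto> \<integral> f d\<mu>\<close> on the continuous functions, with pointwise convergence.
\<close>

definition weak_star :: "'x topology \<Rightarrow> 'x measure topology" where
  "weak_star X = pullback_topology (Prob X)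
     (\<lambda>\<mu>. \<lambda>f \<in> cont_funs X. integral\<^sup>L \<mu> f) (product_topology (\<lambda>_. euclideanreal) (cont_funs X))"

definition strongly_proximal ::
  "('g, 'm) monoid_scheme \<Rightarrow> 'x topology \<Rightarrow> ('g \<Rightarrow> 'x \<Rightarrow> 'x) \<Rightarrow> bool" where
  "strongly_proximal G X \<alpha> \<longleftrightarrow>
     (\<forall>\<mu> \<in> Prob X. \<exists>x \<in> topspace X.
        return (borel_measure_of X) x \<in>
          weak_star X closure_of ((\<lambda>g. distr \<mu> (borel_measure_of X) (\<alpha> g)) ` carrier G))"

definition equivariant ::
  "('g, 'm) monoid_scheme \<Rightarrow> 'x topology \<Rightarrow> ('g \<Rightarrow> 'x \<Rightarrow> 'x) \<Rightarrow> ('g \<Rightarrow> 'y \<Rightarrow> 'y) \<Rightarrow> ('x \<Rightarrow> 'y) \<Rightarrow> bool" where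
  "equivariant G X \<alpha> \<beta> h \<longleftrightarrow> (\<forall>g \<in> carrier G. \<forall>x \<in> topspace X. h (\<alpha> g x) = \<beta> g (h x))"

definition maps_onto ::
  "('g, 'm) monoid_scheme \<Rightarrow> 'x topology \<Rightarrow> ('g \<Rightarrow> 'x \<Rightarrow> 'x) \<Rightarrow>
   'y topology \<Rightarrow> ('g \<Rightarrow> 'y \<Rightarrow> 'y) \<Rightarrow> bool" where
  "maps_onto G X \<alpha> Y \<beta> \<longleftrightarrow>
     (\<exists>h. continuous_map X Y h \<and> h ` topspace X = topspace Y \<and> equivariant G X \<alpha> \<beta> h)"

definition flow_iso ::
  "('g, 'm) monoid_scheme \<Rightarrow> 'x topology \<Rightarrow> ('g \<Rightarrow> 'x \<Rightarrow> 'x) \<Rightarrow>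
   'y topology \<Rightarrow> ('g \<Rightarrow> 'y \<Rightarrow> 'y) \<Rightarrow> bool" where
  "flow_iso G X \<alpha> Y \<beta> \<longleftrightarrow> (\<exists>h. homeomorphic_map X Y h \<and> equivariant G X \<alpha> \<beta> h)"

definition min_prox_def_flow ::
  "('f, 'r) language \<Rightarrow> ('f, 'r, 'a) fo_structure \<Rightarrow> nat \<Rightarrow> 'a list monoid \<Rightarrow>
   'x topology \<Rightarrow> ('a list \<Rightarrow> 'x \<Rightarrow> 'x) \<Rightarrow> bool" where
  "min_prox_def_flow L M n G X \<alpha> \<longleftrightarrow>
     definable_flow L M n G X \<alpha> \<and> minimal G X \<alpha> \<and> proximal G X \<alpha>"

definition min_sprox_def_flow ::
  "('f, 'r) language \<Rightarrow> ('f, 'r, 'a) fo_structure \<Rightarrow> nat \<Rightarrow> 'a list monoid \<Rightarrow>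
   'x topology \<Rightarrow> ('a list \<Rightarrow> 'x \<Rightarrow> 'x) \<Rightarrow> bool" where
  "min_sprox_def_flow L M n G X \<alpha> \<longleftrightarrow>
     definable_flow L M n G X \<alpha> \<and> minimal G X \<alpha> \<and> strongly_proximal G X \<alpha>"

text \<open>
  Universality quantifies over all minimal flows in the type \<open>'a list set set\<close>. This loses nothing:
  in a minimal flow the orbit of any point \<open>x0\<close> is dense, so sending \<open>x\<close> to the set of all
  \<open>A \<subseteq> G\<close> with \<open>x\<close> in the closure of \<open>A x0\<close> is injective by the Hausdorff property, and every
  minimal flow is isomorphic to one carried by a subset of that type.
\<close>

definition universal_min_prox_def_flow ::
  "('f, 'r) language \<Rightarrow> ('f, 'r, 'a) fo_structure \<Rightarrow> nat \<Rightarrow> 'a list monoid \<Rightarrow>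
   'x topology \<Rightarrow> ('a list \<Rightarrow> 'x \<Rightarrow> 'x) \<Rightarrow> bool" where
  "universal_min_prox_def_flow L M n G X \<alpha> \<longleftrightarrow> min_prox_def_flow L M n G X \<alpha> \<and>
     (\<forall>(Y :: 'a list set set topology) \<beta>.
        min_prox_def_flow L M n G Y \<beta> \<longrightarrow> maps_onto G X \<alpha> Y \<beta>)"

definition universal_min_sprox_def_flow ::
  "('f, 'r) language \<Rightarrow> ('f, 'r, 'a) fo_structure \<Rightarrow> nat \<Rightarrow> 'a list monoid \<Rightarrow>
   'x topology \<Rightarrow> ('a list \<Rightarrow> 'x \<Rightarrow> 'x) \<Rightarrow> bool" where
  "universal_min_sprox_def_flow L M n G X \<alpha> \<longleftrightarrow> min_sprox_def_flow L M n G X \<alpha> \<and>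
     (\<forall>(Y :: 'a list set set topology) \<beta>.
        min_sprox_def_flow L M n G Y \<beta> \<longrightarrow> maps_onto G X \<alpha> Y \<beta>)"

end

theory Submission
  imports Defs
begin

text \<open>
A minimal proximal flow contracts finite sets: every finite set of points can be moved into every
nonempty open set by a single group element (\<open>contract_finite\<close>). Strong proximality asks for the same
with a probability measure \<open>\<mu>\<close> in place of a finite set, and this needs a uniformity that NIP provides.

Suppose that the orbit of \<open>\<mu>\<close> stays away from the Dirac measure at a point \<open>z\<close>. Then there are a
continuous function \<open>F \<ge> 0\<close> with \<open>F z = 0\<close> and an \<open>\<epsilon> > 0\<close> such that \<open>\<integral>x. F (g x) \<partial>\<mu> \<ge> \<epsilon>\<close> for all \<open>g\<close>. So
for every \<open>g\<close> the set \<open>A g\<close> where \<open>F (g x)\<close> is not small has measure bounded below. On the other hand,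
for every finite set of points some \<open>g\<close> makes \<open>F (g x)\<close> very small on all of them, so that no finite set
meets all the sets \<open>A g\<close>. By the theory of Vapnik and Chervonenkis this is impossible for a family of
finite dimension, since a random sample of bounded size is such a net.

The dimension is finite by NIP. The orbit of \<open>z\<close> is dense, so it is enough to consider points \<open>h z\<close>.
A definable set \<open>D\<close> separates the \<open>g\<close> for which \<open>F (g z)\<close> is large from those for which it is
small; consequently \<open>h z\<close> belongs to \<open>A g\<close> or lies far from it according to whether \<open>g h \<in> D\<close>, and
this is an instance of one fixed formula in \<open>g\<close> and \<open>h\<close> (\<open>NIP_group_bounded_shattering\<close>). As NIP is
stated for models carried by sets of formulas, shattering is transferred to such a model by a
Loewenheim-Skolem argument (\<open>small_elementary_substructure\<close>).

The version of the net theorem proved here (\<open>large_evading_family_shatters\<close>) has to cope with the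
gap between large and very small values, and with choices of \<open>g\<close> that need not be measurable in the
sample. Compactness of \<open>X\<close> settles the latter: finitely many \<open>g\<close> serve for all samples of a given size,
so \<open>\<mu>\<close> may be replaced by a discrete distribution. Then a sample of \<open>n\<close> blocks is found on which
\<open>2 ^ n\<close> different patterns occur (\<open>exists_blocks_all_patterns\<close>), although the number of its points is
polynomial in \<open>n\<close>; the Sauer-Shelah lemma turns this into shattered sets of every finite size.

For the universal flows, strongly proximal flows are proximal (\<open>strongly_proximal_imp_proximal\<close>), so
the two classes of minimal definable flows coincide and with them the two universal properties. Two
universal flows are isomorphic because a minimal proximal flow has no endomorphism besides the
identity (\<open>endomorphism_eq_id\<close>).
\<close>

section \<open>Uniform definability of translates and NIP\<close>

lemma eval_tm_cong:
  "(\<And>i. i \<in> fv_tm t \<Longrightarrow> e i = e' i) \<Longrightarrow> eval_tm M e t = eval_tm M e' t"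
proof (induction t)
  case (Fn f ts)
  have "map (eval_tm M e) ts = map (eval_tm M e') ts"
    using Fn by (intro map_cong refl) auto
  then show ?case by (simp only: eval_tm.simps)
qed simp

lemma sat_cong:
  "(\<And>i. i \<in> fv \<phi> \<Longrightarrow> e i = e' i) \<Longrightarrow> sat M e \<phi> = sat M e' \<phi>"
proof (induction \<phi> arbitrary: e e')
  case (Eq s t)
  then show ?case using eval_tm_cong[of s e e' M] eval_tm_cong[of t e e' M] by simp
next
  case (Rl r ts)
  have "map (eval_tm M e) ts = map (eval_tm M e') ts"
    using Rl by (intro map_cong refl eval_tm_cong) auto
  then show ?case by (simp only: sat.simps)
next
  case (Neg \<phi>)
  then show ?case by (metis fv.simps(3) sat.simps(3))
next
  case (Conj \<phi> \<psi>)
  have "sat M e \<phi> = sat M e' \<phi>" by (rule Conj.IH) (use Conj.prems in simp)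
  moreover have "sat M e \<psi> = sat M e' \<psi>" by (rule Conj.IH) (use Conj.prems in simp)
  ultimately show ?case by simp
next
  case (Ex i \<phi>)
  have "sat M (e(i := a)) \<phi> = sat M (e'(i := a)) \<phi>" for a
    using Ex.prems by (intro Ex.IH) simp
  then show ?case by simp
qed

lemma finite_fv_tm: "finite (fv_tm t)"
  by (induction t) auto

lemma finite_fv: "finite (fv \<phi>)"
  by (induction \<phi>) (auto simp: finite_fv_tm)

text \<open>
Bound variables are renamed together with the free ones, so that for an injective \<open>\<pi>\<close> no variable
can be captured and the renamed formula is evaluated by composing the assignment with \<open>\<pi>\<close>.
\<close>

primrec rename_tm :: "(nat \<Rightarrow> nat) \<Rightarrow> 'f tm \<Rightarrow> 'f tm" where
  "rename_tm \<pi> (Var i) = Var (\<pi> i)"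
| "rename_tm \<pi> (Fn f ts) = Fn f (map (rename_tm \<pi>) ts)"

primrec rename_fm :: "(nat \<Rightarrow> nat) \<Rightarrow> ('f, 'r) fm \<Rightarrow> ('f, 'r) fm" where
  "rename_fm \<pi> (Eq s t) = Eq (rename_tm \<pi> s) (rename_tm \<pi> t)"
| "rename_fm \<pi> (Rl r ts) = Rl r (map (rename_tm \<pi>) ts)"
| "rename_fm \<pi> (Neg \<phi>) = Neg (rename_fm \<pi> \<phi>)"
| "rename_fm \<pi> (Conj \<phi> \<psi>) = Conj (rename_fm \<pi> \<phi>) (rename_fm \<pi> \<psi>)"
| "rename_fm \<pi> (Ex i \<phi>) = Ex (\<pi> i) (rename_fm \<pi> \<phi>)"

lemma eval_rename_tm: "eval_tm M e (rename_tm \<pi> t) = eval_tm M (\<lambda>i. e (\<pi> i)) t"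
proof (induction t)
  case (Fn f ts)
  have "map (eval_tm M e \<circ> rename_tm \<pi>) ts = map (eval_tm M (\<lambda>i. e (\<pi> i))) ts"
    by (rule map_cong[OF refl]) (simp only: comp_apply Fn)
  then show ?case by (simp only: rename_tm.simps eval_tm.simps map_map)
qed simp

lemma sat_rename_fm:
  assumes "inj \<pi>"
  shows "sat M e (rename_fm \<pi> \<phi>) = sat M (\<lambda>i. e (\<pi> i)) \<phi>"
proof (induction \<phi> arbitrary: e)
  case (Rl r ts)
  have "map (eval_tm M e \<circ> rename_tm \<pi>) ts = map (eval_tm M (\<lambda>i. e (\<pi> i))) ts"
    by (rule map_cong[OF refl]) (simp only: comp_apply eval_rename_tm)
  then show ?case by (simp only: rename_fm.simps sat.simps map_map)
next
  case (Ex i \<phi>)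
  have "(\<lambda>j. (e(\<pi> i := a)) (\<pi> j)) = (\<lambda>i. e (\<pi> i))(i := a)" for a
    using assms by (auto simp: fun_eq_iff inj_eq)
  then show ?case by (simp only: rename_fm.simps sat.simps Ex)
qed (simp_all add: eval_rename_tm)

lemma wf_rename_tm: "wf_tm L t \<Longrightarrow> wf_tm L (rename_tm \<pi> t)"
  by (induction t) auto

lemma wf_rename_fm: "wf_fm L \<phi> \<Longrightarrow> wf_fm L (rename_fm \<pi> \<phi>)"
  by (induction \<phi>) (auto simp: wf_rename_tm)

lemma fv_rename_tm: "fv_tm (rename_tm \<pi> t) = \<pi> ` fv_tm t"
  by (induction t) auto

lemma fv_rename_fm: "inj \<pi> \<Longrightarrow> fv (rename_fm \<pi> \<phi>) = \<pi> ` fv \<phi>"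
  by (induction \<phi>) (auto simp: fv_rename_tm inj_eq)

primrec exs :: "nat \<Rightarrow> nat \<Rightarrow> ('f, 'r) fm \<Rightarrow> ('f, 'r) fm" where
  "exs 0 N \<phi> = \<phi>"
| "exs (Suc k) N \<phi> = Ex N (exs k (Suc N) \<phi>)"

lemma wf_exs: "wf_fm L (exs k N \<phi>) = wf_fm L \<phi>"
  by (induction k arbitrary: N) auto

lemma fv_exs: "fv (exs k N \<phi>) = fv \<phi> - {N..<N + k}"
  by (induction k arbitrary: N) auto

lemma sat_exs:
  "sat M e (exs k N \<phi>) \<longleftrightarrow>
     (\<exists>xs \<in> tuples M k. sat M (\<lambda>i. if N \<le> i \<and> i < N + k then xs ! (i - N) else e i) \<phi>)"
proof (induction k arbitrary: N e)
  case 0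
  have "(\<lambda>i. if N \<le> i \<and> i < N + 0 then [] ! (i - N) else e i) = e"
    by (auto simp: fun_eq_iff)
  moreover have "tuples M 0 = {[]}" by (auto simp: tuples_def)
  ultimately show ?case by (simp only: exs.simps add_0_right bex_simps) simp
next
  case (Suc k)
  have eq: "(\<lambda>i. if Suc N \<le> i \<and> i < Suc N + k then xs ! (i - Suc N) else (e(N := a)) i) =
      (\<lambda>i. if N \<le> i \<and> i < N + Suc k then (a # xs) ! (i - N) else e i)" for a xs
  proof
    fix i
    show "(if Suc N \<le> i \<and> i < Suc N + k then xs ! (i - Suc N) else (e(N := a)) i) =
      (if N \<le> i \<and> i < N + Suc k then (a # xs) ! (i - N) else e i)"
      by (auto simp: nth_Cons')
  qed
  have tup: "tuples M (Suc k) = (\<lambda>(a, xs). a # xs) ` (univ M \<times> tuples M k)"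
    by (force simp: tuples_def length_Suc_conv)
  show ?case
    unfolding exs.simps sat.simps Suc eq tup by auto
qed

definition skolem_witness ::
  "('f, 'r, 'a) fo_structure \<Rightarrow> 'a \<Rightarrow> ('f, 'r) fm \<Rightarrow> 'a list \<Rightarrow> 'a" where
  "skolem_witness M d \<theta> l = (case \<theta> of
      Ex i \<psi> \<Rightarrow> if \<exists>a \<in> univ M. sat M (((!) l)(i := a)) \<psi>
                then SOME a. a \<in> univ M \<and> sat M (((!) l)(i := a)) \<psi> else d
    | _ \<Rightarrow> d)"

text \<open>
The downward Loewenheim-Skolem theorem is needed in a form where the elementary submodel is carried
by a set of formulas. The Skolem hull of a sequence \<open>c\<close> is therefore generated by a map from formulas
to elements, with formulas in the role of Skolem terms. An equation with \<open>Var i\<close> on the left stands for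
the generator \<open>c i\<close>, and \<open>Conj \<theta> \<psi>\<close> for a witness of the existential formula \<open>\<theta>\<close> at the assignment
listed by \<open>\<psi>\<close>, where a list is coded by nested conjunctions.
\<close>

fun skolem_val :: "('f, 'r, 'a) fo_structure \<Rightarrow> (nat \<Rightarrow> 'a) \<Rightarrow> ('f, 'r) fm \<Rightarrow> 'a"
and skolem_vals :: "('f, 'r, 'a) fo_structure \<Rightarrow> (nat \<Rightarrow> 'a) \<Rightarrow> ('f, 'r) fm \<Rightarrow> 'a list"
where
  "skolem_val M c (Conj \<theta> \<psi>) = skolem_witness M (c 0) \<theta> (skolem_vals M c \<psi>)"
| "skolem_val M c (Eq (Var i) t) = c i"
| "skolem_val M c _ = c 0"
| "skolem_vals M c (Conj \<phi> \<psi>) = skolem_val M c \<phi> # skolem_vals M c \<psi>"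
| "skolem_vals M c _ = []"

lemma skolem_witness_in_univ:
  assumes "d \<in> univ M"
  shows "skolem_witness M d \<theta> l \<in> univ M"
proof (cases \<theta>)
  case (Ex i \<psi>)
  then show ?thesis
    using assms someI_ex[of "\<lambda>a. a \<in> univ M \<and> sat M (((!) l)(i := a)) \<psi>"]
    by (auto simp: skolem_witness_def)
qed (use assms in \<open>simp_all add: skolem_witness_def\<close>)

lemma skolem_witness_sat:
  assumes "a \<in> univ M" "sat M (((!) l)(i := a)) \<psi>"
  shows "sat M (((!) l)(i := skolem_witness M d (Ex i \<psi>) l)) \<psi>"
  using assms someI_ex[of "\<lambda>a. a \<in> univ M \<and> sat M (((!) l)(i := a)) \<psi>"]
  by (auto simp: skolem_witness_def)

lemma skolem_val_in_univ:
  assumes "range c \<subseteq> univ M"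
  shows "skolem_val M c \<phi> \<in> univ M"
proof -
  have c: "c i \<in> univ M" for i using assms by auto
  show ?thesis
    by (cases "(M, c, \<phi>)" rule: skolem_val.cases) (simp_all add: c skolem_witness_in_univ)
qed

lemma skolem_vals_onto:
  assumes "set l \<subseteq> range (skolem_val M c)"
  shows "\<exists>\<psi>. skolem_vals M c \<psi> = l"
  using assms
proof (induction l)
  case Nil
  have "skolem_vals M c (Eq (Var 0) (Var 0)) = []" by simp
  then show ?case by blast
next
  case (Cons a l)
  then obtain \<phi> \<psi> where "a = skolem_val M c \<phi>" "skolem_vals M c \<psi> = l" by auto
  then have "skolem_vals M c (Conj \<phi> \<psi>) = a # l" by simp
  then show ?case by blast
qed

lemma skolem_hull_closed_witness:
  assumes "set l \<subseteq> range (skolem_val M c)"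
  shows "skolem_witness M (c 0) \<theta> l \<in> range (skolem_val M c)"
proof -
  obtain \<psi> where "skolem_vals M c \<psi> = l" using skolem_vals_onto[OF assms] by blast
  then have "skolem_witness M (c 0) \<theta> l = skolem_val M c (Conj \<theta> \<psi>)" by simp
  then show ?thesis by blast
qed

text \<open>
The value of a function is the only witness of \<open>\<exists>x\<^sub>0. x\<^sub>0 = f x\<^sub>1 \<dots> x\<^sub>k\<close>, so closure under functions
is a case of closure under Skolem witnesses.
\<close>

lemma skolem_hull_closed_fun:
  assumes M: "is_structure L M" and c: "range c \<subseteq> univ M" and f: "f \<in> funs L"
    and xs: "length xs = fun_arity L f" "set xs \<subseteq> range (skolem_val M c)"
  shows "fun_int M f xs \<in> range (skolem_val M c)"
proof -
  \<comment> \<open>Position \<open>0\<close> of the assignment is overwritten by the witness; any element of the hull can pad it.\<close>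
  let ?k = "length xs" and ?l = "skolem_val M c (Eq (Var 0) (Var 0)) # xs"
  let ?\<psi> = "Eq (Var 0) (Fn f (map Var [1..<Suc ?k])) :: ('a, 'b) fm"
  have vals: "map (\<lambda>i. (((!) ?l)(0 := a)) i) [1..<Suc ?k] = xs" for a
    by (rule nth_equalityI) (auto simp: nth_Cons' simp del: upt_Suc)
  have sat_iff: "sat M (((!) ?l)(0 := a)) ?\<psi> \<longleftrightarrow> a = fun_int M f xs" for a
    using vals[of a] by (simp add: o_def del: upt_Suc fun_upd_apply) simp
  have "set xs \<subseteq> univ M" using xs(2) skolem_val_in_univ[OF c] by auto
  then have "fun_int M f xs \<in> univ M"
    using M f xs(1) by (auto simp: is_structure_def tuples_def)
  from skolem_witness_sat[OF this, of ?l 0 ?\<psi> "c 0"] sat_iff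
  have "skolem_witness M (c 0) (Ex 0 ?\<psi>) ?l = fun_int M f xs" by blast
  moreover have "skolem_witness M (c 0) (Ex 0 ?\<psi>) ?l \<in> range (skolem_val M c)"
    by (rule skolem_hull_closed_witness) (use xs(2) in \<open>simp only: list.set insert_subset rangeI simp_thms\<close>)
  ultimately show ?thesis by (simp only:)
qed

text \<open>
The Skolem hull of \<open>c\<close>, transported to the formulas that code its elements. The map \<open>v\<close> decodes, and
the last clause is elementarity, proved by the Tarski-Vaught argument: a witness for an existential
formula exists in the hull because it is a Skolem witness.
\<close>

proposition small_elementary_substructure:
  fixes M :: "('f, 'r, 'a) fo_structure" and c :: "nat \<Rightarrow> 'a"
  assumes M: "is_model L T M" and wfT: "\<And>\<phi>. \<phi> \<in> T \<Longrightarrow> wf_fm L \<phi>" and c: "range c \<subseteq> univ M"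
  obtains N :: "('f, 'r) small_structure" and v :: "('f, 'r) fm \<Rightarrow> 'a" where "is_model L T N" "inj_on v (univ N)"
    "v ` univ N \<subseteq> univ M" "range c \<subseteq> v ` univ N"
    "\<And>\<phi> e. wf_fm L \<phi> \<Longrightarrow> range e \<subseteq> univ N \<Longrightarrow> sat N e \<phi> = sat M (\<lambda>i. v (e i)) \<phi>"
proof -
  have str: "is_structure L M" using M by (simp add: is_model_def)
  define v :: "('f, 'r) fm \<Rightarrow> 'a" where "v = skolem_val M c"
  define code where "code = inv_into UNIV v"
  have v_code: "v (code a) = a" if "a \<in> range v" for a
    using that by (simp add: code_def f_inv_into_f)
  define N :: "('f, 'r) small_structure" where
    "N = \<lparr>univ = code ` range v, fun_int = (\<lambda>f xs. code (fun_int M f (map v xs))),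
          rel_int = (\<lambda>r xs. rel_int M r (map v xs))\<rparr>"
  have N_simps: "univ N = code ` range v" "fun_int N f xs = code (fun_int M f (map v xs))"
    "rel_int N r xs = rel_int M r (map v xs)" for f r xs
    by (simp_all add: N_def)
  have range_v: "v ` univ N = range v"
    using v_code unfolding N_simps image_image by simp
  have inj_v: "inj_on v (univ N)"
    using v_code unfolding N_simps by (auto simp: inj_on_def)
  have v_univ: "range v \<subseteq> univ M" using skolem_val_in_univ[OF c] by (auto simp: v_def)
  have closed_fun: "fun_int M f (map v xs) \<in> range v" if "f \<in> funs L" "length xs = fun_arity L f" for f xs
    unfolding v_def by (rule skolem_hull_closed_fun[OF str c that(1)]) (use that(2) in auto)
  have tm: "eval_tm N e t \<in> univ N \<and> v (eval_tm N e t) = eval_tm M (\<lambda>i. v (e i)) t"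
    if "wf_tm L t" "range e \<subseteq> univ N" for e t
    using that(1)
  proof (induction t)
    case (Var i)
    then show ?case using that(2) by auto
  next
    case (Fn f ts)
    let ?xs = "map (eval_tm N e) ts"
    have "map v ?xs = map (eval_tm M (\<lambda>i. v (e i))) ts" using Fn by auto
    moreover have "fun_int M f (map v ?xs) \<in> range v" using Fn.prems by (intro closed_fun) auto
    ultimately show ?case using v_code unfolding eval_tm.simps N_simps by (metis image_eqI)
  qed
  have fm: "sat N e \<phi> = sat M (\<lambda>i. v (e i)) \<phi>" if "wf_fm L \<phi>" "range e \<subseteq> univ N" for e \<phi>
    using that
  proof (induction \<phi> arbitrary: e)
    case (Eq s t)
    have s: "eval_tm N e s \<in> univ N" "v (eval_tm N e s) = eval_tm M (\<lambda>i. v (e i)) s"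
      using tm[of s e] Eq by auto
    have t: "eval_tm N e t \<in> univ N" "v (eval_tm N e t) = eval_tm M (\<lambda>i. v (e i)) t"
      using tm[of t e] Eq by auto
    show ?case using s t inj_onD[OF inj_v] by (metis sat.simps(1))
  next
    case (Rl r ts)
    then have "map v (map (eval_tm N e) ts) = map (eval_tm M (\<lambda>i. v (e i))) ts" using tm by simp
    then show ?case by (simp only: N_simps sat.simps)
  next
    case (Ex i \<phi>)
    let ?E = "\<lambda>j. v (e j)"
    have IH: "sat N (e(i := b)) \<phi> = sat M (?E(i := v b)) \<phi>" if "b \<in> univ N" for b
    proof -
      have "range (e(i := b)) \<subseteq> univ N" using Ex.prems(2) that by auto
      moreover have "(\<lambda>j. v ((e(i := b)) j)) = ?E(i := v b)" by auto
      ultimately show ?thesis using Ex.IH[of "e(i := b)"] Ex.prems(1) by (simp only: wf_fm.simps)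
    qed
    show ?case
    proof
      assume "sat N e (Ex i \<phi>)"
      then obtain b where "b \<in> univ N" "sat N (e(i := b)) \<phi>" by auto
      then show "sat M ?E (Ex i \<phi>)" using IH v_univ by (auto intro!: bexI[of _ "v b"])
    next
      assume "sat M ?E (Ex i \<phi>)"
      then obtain a where a: "a \<in> univ M" "sat M (?E(i := a)) \<phi>" by auto
      obtain m where m: "\<And>j. j \<in> fv \<phi> \<Longrightarrow> j < m"
        using finite_fv[of \<phi>] by (meson finite_nat_set_iff_bounded)
      let ?l = "map ?E [0..<m]"
      \<comment> \<open>A Skolem witness takes a finite list of parameters; the list \<open>?l\<close> covers all free variables.\<close>
      have cong: "sat M (((!) ?l)(i := a')) \<phi> = sat M (?E(i := a')) \<phi>" for a'
        using m by (intro sat_cong) auto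
      define w where "w = skolem_witness M (c 0) (Ex i \<phi>) ?l"
      have "sat M (?E(i := w)) \<phi>"
        using skolem_witness_sat[OF a(1), of ?l i \<phi> "c 0"] a(2) unfolding cong w_def by simp
      moreover have "w \<in> range v"
        unfolding w_def v_def by (rule skolem_hull_closed_witness) auto
      ultimately obtain b where "b \<in> univ N" "sat M (?E(i := v b)) \<phi>"
        using range_v by (metis imageE)
      then show "sat N e (Ex i \<phi>)" using IH by auto
    qed
  qed simp_all
  have "is_structure L N"
    using closed_fun unfolding is_structure_def tuples_def N_simps by auto
  moreover have "holds N \<phi>" if "\<phi> \<in> T" for \<phi>
    unfolding holds_def
  proof (intro allI impI)
    fix e :: "nat \<Rightarrow> ('f, 'r) fm" assume e: "range e \<subseteq> univ N"
    have "range (\<lambda>i. v (e i)) \<subseteq> univ M" using v_univ by auto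
    then have "sat M (\<lambda>i. v (e i)) \<phi>" using M that by (simp add: is_model_def holds_def)
    then show "sat N e \<phi>" using fm[OF wfT[OF that] e] by simp
  qed
  ultimately have "is_model L T N" by (simp add: is_model_def)
  moreover have "range c \<subseteq> v ` univ N"
  proof -
    have "c i = v (Eq (Var i) (Var i))" for i by (simp add: v_def)
    then show ?thesis unfolding range_v by auto
  qed
  ultimately show thesis using that inj_v v_univ range_v fm by metis
qed

text \<open>
The independence property is expressed through small models, whereas \<open>M\<close> may live in any type. That a
formula shatters a set of \<open>n\<close> tuples is witnessed by finitely many elements of \<open>M\<close>, and a small
elementary substructure that contains them shatters a set of the same size.
\<close>

lemma has_IP_if_shatters:
  fixes M :: "('f, 'r, 'a) fo_structure"
  assumes M: "is_model L T M" and wfT: "\<And>\<phi>. \<phi> \<in> T \<Longrightarrow> wf_fm L \<phi>"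
    and \<phi>: "wf_fm L \<phi>" "fv \<phi> \<subseteq> {..<p + q}"
    and sh: "\<And>n. \<exists>A \<subseteq> tuples M p. finite A \<and> card A = n \<and> shatters M \<phi> q A"
  shows "has_IP L T \<phi> p q"
  unfolding has_IP_def
proof
  fix n
  obtain A where A: "A \<subseteq> tuples M p" "finite A" "card A = n" "shatters M \<phi> q A"
    using sh[of n] by blast
  have "\<forall>B. \<exists>b. B \<subseteq> A \<longrightarrow> b \<in> tuples M q \<and> (\<forall>a \<in> A. sat M ((!) (a @ b)) \<phi> \<longleftrightarrow> a \<in> B)"
    using A(4) unfolding shatters_def by blast
  from choice[OF this] obtain b where
    "\<forall>B. B \<subseteq> A \<longrightarrow> b B \<in> tuples M q \<and> (\<forall>a \<in> A. sat M ((!) (a @ b B)) \<phi> \<longleftrightarrow> a \<in> B)"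
    by (rule exE)
  then have b: "b B \<in> tuples M q" "\<And>a. a \<in> A \<Longrightarrow> sat M ((!) (a @ b B)) \<phi> \<longleftrightarrow> a \<in> B"
    if "B \<subseteq> A" for B using that by simp_all
  obtain d where d: "d \<in> univ M" using M by (auto simp: is_model_def is_structure_def)
  define C where "C = insert d ((\<Union>a\<in>A. set a) \<union> (\<Union>B\<in>Pow A. set (b B)))"
  have "finite C" using A(2) by (simp add: C_def)
  have C: "C \<subseteq> univ M" using A(1) b(1) d unfolding C_def tuples_def by auto
  define c where "c = from_nat_into C"
  have "range c = C" unfolding c_def
    using \<open>finite C\<close> by (intro range_from_nat_into countable_finite) (simp_all add: C_def)
  with C have "range c \<subseteq> univ M" by simp
  from small_elementary_substructure[OF M wfT this]
  obtain N :: "('f, 'r) small_structure" and v where N: "is_model L T N" "inj_on v (univ N)"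
    "v ` univ N \<subseteq> univ M" "range c \<subseteq> v ` univ N"
    "\<And>\<phi> e. wf_fm L \<phi> \<Longrightarrow> range e \<subseteq> univ N \<Longrightarrow> sat N e \<phi> = sat M (\<lambda>i. v (e i)) \<phi>" by metis
  define w where "w = inv_into (univ N) v"
  have w: "w x \<in> univ N" "v (w x) = x" if "x \<in> C" for x
    using that N(4) \<open>range c = C\<close> by (auto simp: w_def inv_into_into f_inv_into_f subsetD)
  have AC: "set a \<subseteq> C" if "a \<in> A" for a using that by (auto simp: C_def)
  have BC: "set (b B) \<subseteq> C" if "B \<subseteq> A" for B using that by (auto simp: C_def)
  have len: "length a = p" if "a \<in> A" for a using A(1) that by (auto simp: tuples_def)
  have lenb: "length (b B) = q" if "B \<subseteq> A" for B using b(1)[OF that] by (simp add: tuples_def)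
  have transfer: "sat N ((!) (map w a @ map w (b B))) \<phi> = sat M ((!) (a @ b B)) \<phi>"
    if "a \<in> A" "B \<subseteq> A" for a B
  proof -
    let ?x = "a @ b B"
    \<comment> \<open>The values of \<open>(!)\<close> beyond the length of a list may lie outside of the model, so they are replaced.\<close>
    define e where "e i = (if i < p + q then w (?x ! i) else w d)" for i
    have x: "?x ! i \<in> C" if "i < p + q" for i
      using that AC[OF \<open>a \<in> A\<close>] BC[OF \<open>B \<subseteq> A\<close>] len[OF \<open>a \<in> A\<close>] lenb[OF \<open>B \<subseteq> A\<close>] nth_mem[of i ?x]
      by (auto simp del: nth_mem)
    have "d \<in> C" by (simp add: C_def)
    then have "range e \<subseteq> univ N" using w(1) x by (auto simp: e_def)
    have "sat N ((!) (map w a @ map w (b B))) \<phi> = sat N e \<phi>"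
    proof (rule sat_cong)
      fix i assume "i \<in> fv \<phi>"
      then have "i < p + q" using \<phi>(2) by auto
      then show "(map w a @ map w (b B)) ! i = e i"
        using len[OF \<open>a \<in> A\<close>] lenb[OF \<open>B \<subseteq> A\<close>] by (simp add: e_def nth_map flip: map_append)
    qed
    also have "\<dots> = sat M (\<lambda>i. v (e i)) \<phi>" using N(5)[OF \<phi>(1) \<open>range e \<subseteq> univ N\<close>] .
    also have "\<dots> = sat M ((!) ?x) \<phi>"
    proof (rule sat_cong)
      fix i assume "i \<in> fv \<phi>"
      then have "i < p + q" using \<phi>(2) by auto
      then show "(\<lambda>i. v (e i)) i = ?x ! i" using w(2) x by (simp add: e_def)
    qed
    finally show ?thesis .
  qed
  have inj_map: "inj_on (map w) A"
  proof (rule inj_onI)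
    fix a a' assume a: "a \<in> A" "a' \<in> A" "map w a = map w a'"
    have "map v (map w x) = x" if "x \<in> A" for x
      using AC[OF that] w(2) by (auto intro!: map_idI)
    then show "a = a'" using a by metis
  qed
  have "shatters N \<phi> q (map w ` A)"
    unfolding shatters_def
  proof (intro allI impI)
    fix B' assume "B' \<subseteq> map w ` A"
    then obtain B where B: "B \<subseteq> A" "B' = map w ` B" by (auto simp: subset_image_iff)
    have "map w (b B) \<in> tuples N q"
      using lenb[OF B(1)] BC[OF B(1)] w(1) by (auto simp: tuples_def)
    moreover have "sat N ((!) (map w a @ map w (b B))) \<phi> \<longleftrightarrow> map w a \<in> B'" if "a \<in> A" for a
      using transfer[OF that B(1)] b(2)[OF B(1) that] inj_on_image_mem_iff[OF inj_map that B(1)] B(2) by simp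
    ultimately show "\<exists>b\<in>tuples N q. \<forall>a\<in>map w ` A. sat N ((!) (a @ b)) \<phi> \<longleftrightarrow> a \<in> B'"
      by blast
  qed
  moreover have "map w ` A \<subseteq> tuples N p"
    using len AC w(1) unfolding tuples_def by fastforce
  moreover have "finite (map w ` A)" "card (map w ` A) = n"
    using A(2,3) inj_map by (auto simp: card_image)
  ultimately show "\<exists>N :: ('f, 'r) small_structure. is_model L T N \<and>
      (\<exists>A \<subseteq> tuples N p. finite A \<and> card A = n \<and> shatters N \<phi> q A)"
    using N(1) by blast
qed

text \<open>
Translates of a definable set form a uniformly definable family:
\<open>g \<otimes> h \<in> D\<close> if and only if some \<open>z\<close> satisfies both \<open>z = g \<otimes> h\<close> and \<open>z \<in> D\<close>. The formula has \<open>h\<close> as its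
object variables, while \<open>g\<close> and the parameters \<open>b\<close> of the group and of \<open>D\<close> are its parameter variables.
\<close>

lemma definable_translate_formula:
  assumes G: "definable_group L M n G" and D: "definable_set L M n D"
  obtains \<phi> q b where "wf_fm L \<phi>" "fv \<phi> \<subseteq> {..<n + (n + q)}" "b \<in> tuples M q"
    "\<And>g h. g \<in> carrier G \<Longrightarrow> h \<in> carrier G \<Longrightarrow> sat M ((!) (h @ g @ b)) \<phi> \<longleftrightarrow> g \<otimes>\<^bsub>G\<^esub> h \<in> D"
proof -
  have car: "length g = n \<and> set g \<subseteq> univ M" if "g \<in> carrier G" for g
    using G that by (auto simp: definable_group_def definable_set_def tuples_def)
  have mult: "g \<otimes>\<^bsub>G\<^esub> h \<in> carrier G" if "g \<in> carrier G" "h \<in> carrier G" for g h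
    using G that by (auto simp: definable_group_def group.is_monoid monoid.m_closed)
  obtain \<theta> q1 c where \<theta>: "c \<in> tuples M q1" "wf_fm L \<theta>" "fv \<theta> \<subseteq> {..<3 * n + q1}"
    "{a @ b @ (a \<otimes>\<^bsub>G\<^esub> b) | a b. a \<in> carrier G \<and> b \<in> carrier G}
      = {a \<in> tuples M (3 * n). sat M ((!) (a @ c)) \<theta>}"
    using G unfolding definable_group_def definable_set_def by blast
  obtain \<psi> q0 d where \<psi>: "d \<in> tuples M q0" "wf_fm L \<psi>" "fv \<psi> \<subseteq> {..<n + q0}"
    "D = {a \<in> tuples M n. sat M ((!) (a @ d)) \<psi>}"
    using D unfolding definable_set_def by blast
  have lc: "length c = q1" and ld: "length d = q0" using \<theta>(1) \<psi>(1) by (auto simp: tuples_def)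
  \<comment> \<open>The variables are laid out as \<open>h, g, c, d, z\<close>, where \<open>c\<close> and \<open>d\<close> are the parameters of the graph of the
    multiplication and of \<open>D\<close>, and \<open>z\<close> starts at \<open>N\<close>. Then \<open>\<pi>\<close> moves the layout \<open>g, h, z, c\<close> and \<open>\<rho>\<close> the
    layout \<open>z, d\<close> to these places. Variables that occur only bound go beyond all of them.\<close>
  define N where "N = 2 * n + q1 + q0"
  define \<pi> where "\<pi> i = (if i < n then n + i else if i < 2 * n then i - n
     else if i < 3 * n then N + (i - 2 * n) else if i < 3 * n + q1 then i - n else N + i)" for i
  define \<rho> where "\<rho> i = (if i < n then N + i else if i < n + q0 then n + q1 + i else N + i)" for i
  have inj: "inj \<pi>" "inj \<rho>"
    by (auto simp: inj_def \<pi>_def \<rho>_def N_def split: if_splits)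
  define \<phi> where "\<phi> = exs n N (Conj (rename_fm \<pi> \<theta>) (rename_fm \<rho> \<psi>))"
  show thesis
  proof
    show "wf_fm L \<phi>" using \<theta>(2) \<psi>(2) by (simp add: \<phi>_def wf_exs wf_rename_fm)
    have "\<pi> i < N + n \<and> (\<pi> i < N \<longrightarrow> \<pi> i < 2 * n + q1 + q0)" if "i < 3 * n + q1" for i
      using that by (auto simp: \<pi>_def N_def)
    moreover have "\<rho> i < N + n" if "i < n + q0" for i
      using that by (auto simp: \<rho>_def N_def)
    ultimately have "fv (Conj (rename_fm \<pi> \<theta>) (rename_fm \<rho> \<psi>)) \<subseteq> {..<N + n}"
      using \<theta>(3) \<psi>(3) by (auto simp: fv_rename_fm inj)
    then show "fv \<phi> \<subseteq> {..<n + (n + (q1 + q0))}"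
      by (auto simp: \<phi>_def fv_exs N_def)
    show "c @ d \<in> tuples M (q1 + q0)" using \<theta>(1) \<psi>(1) by (auto simp: tuples_def)
    fix g h assume gh: "g \<in> carrier G" "h \<in> carrier G"
    note lg = car[OF gh(1)] car[OF gh(2)]
    let ?e = "\<lambda>z i. if N \<le> i \<and> i < N + n then z ! (i - N) else (h @ g @ c @ d) ! i"
    have "sat M (?e z) (Conj (rename_fm \<pi> \<theta>) (rename_fm \<rho> \<psi>)) \<longleftrightarrow>
        z = g \<otimes>\<^bsub>G\<^esub> h \<and> z \<in> D" if z: "z \<in> tuples M n" for z
    proof -
      have lz: "length z = n" using z by (simp add: tuples_def)
      have "sat M (\<lambda>i. ?e z (\<pi> i)) \<theta> = sat M ((!) ((g @ h @ z) @ c)) \<theta>"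
      proof (rule sat_cong)
        fix i assume "i \<in> fv \<theta>"
        then have "i < 3 * n + q1" using \<theta>(3) by auto
        have len: "length g = n" "length h = n" using lg by auto
        consider "i < n" | "n \<le> i" "i < 2 * n" | "2 * n \<le> i" "i < 3 * n" | "3 * n \<le> i"
          by linarith
        then show "(\<lambda>i. ?e z (\<pi> i)) i = ((g @ h @ z) @ c) ! i"
          using len lz lc ld \<open>i < 3 * n + q1\<close>
          by cases (simp_all add: \<pi>_def N_def nth_append, (auto simp: mult_2)?)
      qed
      also have "\<dots> \<longleftrightarrow> g @ h @ z \<in> {a @ b @ (a \<otimes>\<^bsub>G\<^esub> b) | a b. a \<in> carrier G \<and> b \<in> carrier G}"
        unfolding \<theta>(4) using z lg by (auto simp: tuples_def)
      also have "\<dots> \<longleftrightarrow> z = g \<otimes>\<^bsub>G\<^esub> h"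
        using gh lg car by (auto simp: append_eq_append_conv)
      finally have 1: "sat M (\<lambda>i. ?e z (\<pi> i)) \<theta> \<longleftrightarrow> z = g \<otimes>\<^bsub>G\<^esub> h" .
      have "sat M (\<lambda>i. ?e z (\<rho> i)) \<psi> = sat M ((!) (z @ d)) \<psi>"
      proof (rule sat_cong)
        fix i assume "i \<in> fv \<psi>"
        then have "i < n + q0" using \<psi>(3) by auto
        then show "(\<lambda>i. ?e z (\<rho> i)) i = (z @ d) ! i"
          using lg lz lc ld by (auto simp: \<rho>_def N_def nth_append)
      qed
      then have 2: "sat M (\<lambda>i. ?e z (\<rho> i)) \<psi> \<longleftrightarrow> z \<in> D" using z unfolding \<psi>(4) by simp
      show ?thesis using 1 2 by (simp add: sat_rename_fm inj)
    qed
    moreover have "g \<otimes>\<^bsub>G\<^esub> h \<in> tuples M n" using car[OF mult[OF gh]] by (simp add: tuples_def)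
    ultimately show "sat M ((!) (h @ g @ c @ d)) \<phi> \<longleftrightarrow> g \<otimes>\<^bsub>G\<^esub> h \<in> D"
      unfolding \<phi>_def sat_exs by blast
  qed
qed

text \<open>
The form in which NIP enters the dynamics: the translates of a definable set by the group form a
family of finite Vapnik-Chervonenkis dimension.
\<close>

proposition NIP_group_bounded_shattering:
  assumes T: "complete_theory L T" "NIP_theory L T" and M: "is_model L T M"
    and G: "definable_group L M n G" and D: "definable_set L M n D"
  shows "\<exists>k. \<forall>U \<subseteq> carrier G. finite U \<longrightarrow> card U = k \<longrightarrow>
     \<not> (\<forall>B \<subseteq> U. \<exists>g \<in> carrier G. \<forall>h \<in> U. g \<otimes>\<^bsub>G\<^esub> h \<in> D \<longleftrightarrow> h \<in> B)"
proof (rule ccontr)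
  assume "\<not> ?thesis"
  then have sh: "\<exists>U \<subseteq> carrier G. finite U \<and> card U = k \<and>
     (\<forall>B \<subseteq> U. \<exists>g \<in> carrier G. \<forall>h \<in> U. g \<otimes>\<^bsub>G\<^esub> h \<in> D \<longleftrightarrow> h \<in> B)" for k
    by (simp only: not_ex not_all not_imp not_not) metis
  obtain \<phi> q b where \<phi>: "wf_fm L \<phi>" "fv \<phi> \<subseteq> {..<n + (n + q)}" "b \<in> tuples M q"
    "\<And>g h. g \<in> carrier G \<Longrightarrow> h \<in> carrier G \<Longrightarrow> sat M ((!) (h @ g @ b)) \<phi> \<longleftrightarrow> g \<otimes>\<^bsub>G\<^esub> h \<in> D"
    using definable_translate_formula[OF G D] by blast
  have car: "carrier G \<subseteq> tuples M n"
    using G by (auto simp: definable_group_def definable_set_def)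
  have "has_IP L T \<phi> n (n + q)"
  proof (rule has_IP_if_shatters[OF M _ \<phi>(1,2)])
    show "wf_fm L \<phi>" if "\<phi> \<in> T" for \<phi>
      using T(1) that by (auto simp: complete_theory_def sentence_def)
    fix k
    obtain U where U: "U \<subseteq> carrier G" "finite U" "card U = k"
      "\<And>B. B \<subseteq> U \<Longrightarrow> \<exists>g \<in> carrier G. \<forall>h \<in> U. g \<otimes>\<^bsub>G\<^esub> h \<in> D \<longleftrightarrow> h \<in> B"
      using sh[of k] by blast
    have "shatters M \<phi> (n + q) U"
      unfolding shatters_def
    proof (intro allI impI)
      fix B assume "B \<subseteq> U"
      then obtain g where g: "g \<in> carrier G" "\<forall>h \<in> U. g \<otimes>\<^bsub>G\<^esub> h \<in> D \<longleftrightarrow> h \<in> B"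
        using U(4) by blast
      have "g @ b \<in> tuples M (n + q)" using car g(1) \<phi>(3) by (fastforce simp: tuples_def)
      moreover have "\<forall>h\<in>U. sat M ((!) (h @ g @ b)) \<phi> \<longleftrightarrow> h \<in> B"
        using \<phi>(4) g U(1) by blast
      ultimately show "\<exists>b\<in>tuples M (n + q). \<forall>a\<in>U. sat M ((!) (a @ b)) \<phi> \<longleftrightarrow> a \<in> B"
        by blast
    qed
    then show "\<exists>A\<subseteq>tuples M n. finite A \<and> card A = k \<and> shatters M \<phi> (n + q) A"
      using U(1-3) car by blast
  qed
  then show False using T(2) \<phi>(1,2) unfolding NIP_theory_def by blast
qed

section \<open>Shattering and the Sauer-Shelah lemma\<close>

text \<open>
The family \<open>F\<close> cuts every subset out of \<open>A\<close>: the condition on set systems that corresponds to the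
shattering of tuples by a formula.
\<close>

definition traces_shatter :: "'a set set \<Rightarrow> 'a set \<Rightarrow> bool" where
  "traces_shatter F A \<longleftrightarrow> (\<forall>B \<subseteq> A. \<exists>R \<in> F. R \<inter> A = B)"

lemma traces_shatter_subset:
  assumes "traces_shatter F A" "A' \<subseteq> A"
  shows "traces_shatter F A'"
  unfolding traces_shatter_def
proof (intro allI impI)
  fix B assume "B \<subseteq> A'"
  then obtain R where "R \<in> F" "R \<inter> A = B"
    using assms unfolding traces_shatter_def by (meson order_trans)
  then show "\<exists>R\<in>F. R \<inter> A' = B"
    using \<open>B \<subseteq> A'\<close> assms(2) by (intro bexI[of _ R]) auto
qed

text \<open>
Pajor's form of the Sauer-Shelah lemma, which admits a direct induction on the ground set: split \<open>F\<close>
according to whether a set contains the new point \<open>x\<close>, and remove \<open>x\<close>. A set \<open>A\<close> that is shattered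
by only one of the two halves counts once, and a set \<open>A\<close> shattered by both counts twice, because then
\<open>F\<close> also shatters \<open>insert x A\<close>.
\<close>

lemma card_le_card_shattered:
  assumes "finite U" "F \<subseteq> Pow U"
  shows "card F \<le> card {A. A \<subseteq> U \<and> traces_shatter F A}"
  using assms
proof (induction U arbitrary: F rule: finite_induct)
  case empty
  show ?case
  proof (cases "F = {}")
    case False
    then have "F = {{}}" using empty by auto
    then have "{A. A \<subseteq> {} \<and> traces_shatter F A} = {{}}"
      by (auto simp: traces_shatter_def)
    then show ?thesis using \<open>F = {{}}\<close> by simp
  qed simp
next
  case (insert x U)
  define F0 where "F0 = {R \<in> F. x \<notin> R}"
  define F1 where "F1 = (\<lambda>R. R - {x}) ` {R \<in> F. x \<in> R}"
  let ?S = "\<lambda>F. {A. A \<subseteq> U \<and> traces_shatter F A}"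
  let ?T = "{A. A \<subseteq> insert x U \<and> traces_shatter F A}"
  have fin: "finite F" "finite (?S F0)" "finite (?S F1)" "finite ?T"
    using insert.hyps insert.prems finite_subset[of F "Pow (insert x U)"] by auto
  have "inj_on (\<lambda>R. R - {x}) {R \<in> F. x \<in> R}"
    by (auto simp: inj_on_def)
  then have c1: "card F1 = card {R \<in> F. x \<in> R}"
    unfolding F1_def by (rule card_image)
  have "F = F0 \<union> {R \<in> F. x \<in> R}" "F0 \<inter> {R \<in> F. x \<in> R} = {}"
    by (auto simp: F0_def)
  then have "card F = card F0 + card F1"
    using fin(1) c1 by (metis (no_types, lifting) card_Un_disjoint finite_Un)
  also have "\<dots> \<le> card (?S F0) + card (?S F1)"
    using insert.prems by (intro add_mono insert.IH) (auto simp: F0_def F1_def)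
  also have "\<dots> = card (?S F0 \<union> ?S F1) + card (?S F0 \<inter> ?S F1)"
    using fin by (intro card_Un_Int)
  also have "card (?S F0 \<inter> ?S F1) = card (insert x ` (?S F0 \<inter> ?S F1))"
    using insert.hyps by (intro card_image[symmetric]) (auto simp: inj_on_def)
  also have "card (?S F0 \<union> ?S F1) + \<dots> = card ((?S F0 \<union> ?S F1) \<union> insert x ` (?S F0 \<inter> ?S F1))"
    using fin insert.hyps by (intro card_Un_disjoint[symmetric]) auto
  also have "\<dots> \<le> card ?T"
  proof (intro card_mono fin subsetI)
    fix A assume "A \<in> (?S F0 \<union> ?S F1) \<union> insert x ` (?S F0 \<inter> ?S F1)"
    then consider "A \<in> ?S F0" | "A \<in> ?S F1" | A' where "A = insert x A'" "A' \<in> ?S F0" "A' \<in> ?S F1"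
      by blast
    then show "A \<in> ?T"
    proof cases
      case 1
      then show ?thesis unfolding traces_shatter_def F0_def by blast
    next
      case 2
      have "traces_shatter F A"
        unfolding traces_shatter_def
      proof (intro allI impI)
        fix B assume "B \<subseteq> A"
        then obtain R where "R \<in> F" "(R - {x}) \<inter> A = B"
          using 2 unfolding traces_shatter_def F1_def by blast
        moreover have "x \<notin> A" using 2 insert.hyps(2) by blast
        ultimately show "\<exists>R\<in>F. R \<inter> A = B" by blast
      qed
      then show ?thesis using 2 by blast
    next
      case 3
      have "traces_shatter F A"
        unfolding traces_shatter_def
      proof (intro allI impI)
        fix B assume B: "B \<subseteq> A"
        have "x \<notin> A'" using 3(2) insert.hyps(2) by blast
        show "\<exists>R\<in>F. R \<inter> A = B"
        proof (cases "x \<in> B")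
          case True
          have "B - {x} \<subseteq> A'" using B 3(1) by blast
          then obtain R' where "R' \<in> F1" "R' \<inter> A' = B - {x}"
            using 3(3) unfolding traces_shatter_def by blast
          then obtain R where "R \<in> F" "x \<in> R" "(R - {x}) \<inter> A' = B - {x}"
            unfolding F1_def by blast
          then have "R \<inter> A = B" using 3(1) True \<open>x \<notin> A'\<close> by blast
          then show ?thesis using \<open>R \<in> F\<close> by blast
        next
          case False
          then have "B \<subseteq> A'" using B 3(1) by blast
          then obtain R where "R \<in> F" "x \<notin> R" "R \<inter> A' = B"
            using 3(2) unfolding traces_shatter_def F0_def by blast
          then have "R \<inter> A = B" using 3(1) by blast
          then show ?thesis using \<open>R \<in> F\<close> by blast
        qed
      qed
      then show ?thesis using 3(1,2) by blast
    qed
  qed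
  finally show ?case .
qed

text \<open>
A subset with at most \<open>d\<close> elements is listed by a word of length \<open>d\<close> over \<open>U\<close> together with a blank.
\<close>

lemma card_small_subsets_le:
  assumes "finite U"
  shows "card {A. A \<subseteq> U \<and> card A \<le> d} \<le> (card U + 1) ^ d"
proof -
  let ?U = "insert None (Some ` U)"
  let ?L = "{l. set l \<subseteq> ?U \<and> length l = d}"
  have finL: "finite ?L" using assms by (intro finite_lists_length_eq) auto
  have "{A. A \<subseteq> U \<and> card A \<le> d} \<subseteq> (\<lambda>l. {x. Some x \<in> set l}) ` ?L"
  proof
    fix A assume A: "A \<in> {A. A \<subseteq> U \<and> card A \<le> d}"
    then obtain xs where xs: "set xs = A" "distinct xs"
      using assms finite_distinct_list[of A] finite_subset[of A U] by auto
    let ?l = "map Some xs @ replicate (d - length xs) None"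
    have "length xs = card A" using xs distinct_card by fastforce
    then have "?l \<in> ?L" "{x. Some x \<in> set ?l} = A"
      using A xs by auto
    then show "A \<in> (\<lambda>l. {x. Some x \<in> set l}) ` ?L" by (intro image_eqI[of _ _ ?l]) simp_all
  qed
  then have "card {A. A \<subseteq> U \<and> card A \<le> d} \<le> card ((\<lambda>l. {x. Some x \<in> set l}) ` ?L)"
    using finL by (intro card_mono) auto
  also have "\<dots> \<le> card ?L" using finL by (rule card_image_le)
  also have "\<dots> = card ?U ^ d" using assms by (intro card_lists_length_eq) auto
  also have "card ?U = card U + 1"
    using assms by (subst card_insert_disjoint) (auto simp: card_image)
  finally show ?thesis .
qed

lemma sauer_shelah:
  assumes "finite U" "F \<subseteq> Pow U" "(card U + 1) ^ d < card F"
  shows "\<exists>A \<subseteq> U. card A = Suc d \<and> traces_shatter F A"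
proof -
  have "\<not> {A. A \<subseteq> U \<and> traces_shatter F A} \<subseteq> {A. A \<subseteq> U \<and> card A \<le> d}"
  proof
    assume "{A. A \<subseteq> U \<and> traces_shatter F A} \<subseteq> {A. A \<subseteq> U \<and> card A \<le> d}"
    then have "card {A. A \<subseteq> U \<and> traces_shatter F A} \<le> card {A. A \<subseteq> U \<and> card A \<le> d}"
      using assms(1) by (intro card_mono) auto
    then show False
      using card_le_card_shattered[OF assms(1,2)] card_small_subsets_le[OF assms(1), of d] assms(3) by linarith
  qed
  then obtain A where A: "A \<subseteq> U" "traces_shatter F A" "\<not> card A \<le> d" by blast
  then have "Suc d \<le> card A" by simp
  then obtain A' where "A' \<subseteq> A" "card A' = Suc d" using obtain_subset_with_card_n by metis
  then show ?thesis using A traces_shatter_subset by blast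
qed

text \<open>
The base is one more than the number of points in \<open>n\<close> blocks of \<open>n * c\<close> points each: such a sample is
too small, for a suitable \<open>n\<close>, to carry \<open>2 ^ n\<close> distinct traces of a family that shatters no set
with more than \<open>d\<close> points.
\<close>

lemma polynomial_less_two_power:
  fixes c d :: nat
  shows "\<exists>n\<ge>1. (n * (n * c) + 1) ^ d < 2 ^ n"
proof -
  have "eventually (\<lambda>n::nat. (real n * (real n * real c) + 1) ^ d < 2 ^ n) at_top"
  proof -
    have "(\<lambda>n::nat. (real n * (real n * real c) + 1) ^ d / 2 ^ n) \<longlonglongrightarrow> 0"
    proof (rule Lim_null_comparison)
      show "eventually (\<lambda>n. norm ((real n * (real n * real c) + 1) ^ d / 2 ^ n)
          \<le> (real c + 1) ^ d * (real n ^ (2 * d) * (1 / 2) ^ n)) at_top"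
        using eventually_ge_at_top[of 1]
      proof eventually_elim
        case (elim n)
        have "real n * (real n * real c) + 1 \<le> (real c + 1) * (real n)\<^sup>2"
        proof -
          have "1 \<le> real n * real n"
            using elim mult_mono[of 1 "real n" 1 "real n"] by simp
          then show ?thesis by (simp add: algebra_simps power2_eq_square)
        qed
        then have "(real n * (real n * real c) + 1) ^ d \<le> ((real c + 1) * (real n)\<^sup>2) ^ d"
          by (intro power_mono) auto
        then show ?case
          by (simp add: power_mult_distrib power_mult power_divide divide_right_mono flip: power_mult)
      qed
      have "filterlim (\<lambda>n::nat. real n * ln 2) at_top at_top"
        by (intro filterlim_at_top_mult_tendsto_pos[OF tendsto_const _ filterlim_real_sequentially]) simp
      from filterlim_compose[OF tendsto_power_div_exp_0[of "2 * d"] this]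
      have "(\<lambda>n. (real n * ln 2) ^ (2 * d) / exp (real n * ln 2)) \<longlonglongrightarrow> 0" .
      moreover have "exp (real n * ln 2) = 2 ^ n" for n
        by (simp add: exp_of_nat_mult)
      ultimately have "(\<lambda>n. (real n * ln 2) ^ (2 * d) / 2 ^ n) \<longlonglongrightarrow> 0"
        by simp
      from tendsto_mult_right_zero[OF this, of "(real c + 1) ^ d / ln 2 ^ (2 * d)"]
      show "(\<lambda>n. (real c + 1) ^ d * (real n ^ (2 * d) * (1 / 2) ^ n)) \<longlonglongrightarrow> 0"
        by (simp add: power_mult_distrib power_divide)
    qed
    then have "eventually (\<lambda>n::nat. (real n * (real n * real c) + 1) ^ d / 2 ^ n < 1) at_top"
      by (rule order_tendstoD) simp
    then show ?thesis by eventually_elim (simp add: field_simps)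
  qed
  then have "eventually (\<lambda>n::nat. n \<ge> 1 \<and> (real n * (real n * real c) + 1) ^ d < 2 ^ n) at_top"
    using eventually_ge_at_top[of 1] by eventually_elim auto
  then obtain n :: nat where "n \<ge> 1" "(real n * (real n * real c) + 1) ^ d < 2 ^ n"
    by (metis (mono_tags, lifting) eventually_at_top_linorder order_refl)
  then have "real ((n * (n * c) + 1) ^ d) < real (2 ^ n)" by (simp add: algebra_simps)
  then have "(n * (n * c) + 1) ^ d < 2 ^ n" by (simp only: of_nat_less_iff)
  with \<open>n \<ge> 1\<close> show ?thesis by blast
qed

section \<open>Random samples in blocks\<close>

lemma prob_block_misses_le:
  fixes p :: "'x pmf"
  assumes "finite L" "{i} \<times> {..<m} \<subseteq> L" "measure_pmf.prob p E \<ge> \<epsilon>"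
  shows "measure_pmf.prob (Pi_pmf L dflt (\<lambda>_. p)) {z. \<forall>k<m. z (i, k) \<notin> E} \<le> (1 - \<epsilon>) ^ m"
proof -
  define F where "F = (\<lambda>l :: 'a \<times> nat. if l \<in> {i} \<times> {..<m} then - E else UNIV)"
  have "{z :: 'a \<times> nat \<Rightarrow> 'x. \<forall>k<m. z (i, k) \<notin> E} = Pi L F"
    using assms(2) by (auto simp: F_def Pi_def)
  then have "measure_pmf.prob (Pi_pmf L dflt (\<lambda>_. p)) {z. \<forall>k<m. z (i, k) \<notin> E}
      = (\<Prod>l\<in>L. measure_pmf.prob p (F l))"
    using assms(1) by (simp add: measure_Pi_pmf_Pi)
  also have "\<dots> = (\<Prod>l\<in>{i} \<times> {..<m}. measure_pmf.prob p (- E))"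
    using assms(1,2) by (intro prod.mono_neutral_cong_right) (auto simp: F_def)
  also have "\<dots> = (1 - measure_pmf.prob p E) ^ m"
    using measure_pmf.prob_compl[of E p] by (simp add: Compl_eq_Diff_UNIV)
  also have "\<dots> \<le> (1 - \<epsilon>) ^ m"
    using assms(3) by (intro power_mono) auto
  finally show ?thesis .
qed

text \<open>
Draw \<open>n\<close> blocks of \<open>m\<close> points independently. The blocks in \<open>J\<close> are independent of the others, so
condition on them: there is a \<open>g \<in> S\<close>, depending on the blocks in \<open>J\<close> only, such that they lie inside
\<open>B g\<close>. Each of the other blocks misses the large set \<open>A g\<close> with probability at most
\<open>(1 - \<epsilon>) ^ m\<close>. Since the distribution is discrete, the choice of \<open>g\<close> raises no question of
measurability.
\<close>

lemma prob_bad_pattern_le: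
  fixes p :: "'x pmf" and A B :: "'g \<Rightarrow> 'x set" and n m :: nat and \<epsilon> :: real
  assumes supp: "set_pmf p \<subseteq> X"
    and A: "\<And>g. g \<in> S \<Longrightarrow> \<epsilon> \<le> measure_pmf.prob p (A g)"
    and avoid: "\<And>x. x \<in> {..<n} \<times> {..<m} \<rightarrow> X \<Longrightarrow> \<exists>g\<in>S. \<forall>l\<in>{..<n} \<times> {..<m}. x l \<in> B g"
    and J: "J \<subseteq> {..<n}"
  shows "measure_pmf.prob (Pi_pmf ({..<n} \<times> {..<m}) dflt (\<lambda>_. p))
     {x. \<not> (\<exists>g\<in>S. (\<forall>j\<in>J. \<forall>k<m. x (j, k) \<in> B g) \<and> (\<forall>i\<in>{..<n} - J. \<exists>k<m. x (i, k) \<in> A g))}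
     \<le> n * (1 - \<epsilon>) ^ m" (is "measure_pmf.prob ?P ?Bad \<le> ?c")
proof -
  let ?I = "{..<n} \<times> {..<m}" and ?K = "J \<times> {..<m}" and ?L = "({..<n} - J) \<times> {..<m}"
  let ?PK = "Pi_pmf ?K dflt (\<lambda>_. p)" and ?PL = "Pi_pmf ?L dflt (\<lambda>_. p)"
  let ?merge = "\<lambda>y z l. if l \<in> ?K then y l else z l"
  have fin: "finite J" using finite_subset[OF J] by simp
  have ne: "X \<noteq> {}" using supp set_pmf_not_empty[of p] by blast
  obtain g0 where "g0 \<in> S" using avoid[of "\<lambda>_. SOME x. x \<in> X"] some_in_eq[of X] ne by (metis Pi_I)
  then have "\<epsilon> \<le> 1" using A[of g0] measure_pmf.prob_le_1[where M = p and A = "A g0"] by linarith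
  then have c0: "?c \<ge> 0" by simp
  have IKL: "?I = ?K \<union> ?L" using J by auto
  have P: "?P = bind_pmf ?PK (\<lambda>y. map_pmf (?merge y) ?PL)"
  proof -
    have "?P = map_pmf (\<lambda>(y, z). ?merge y z) (pair_pmf ?PK ?PL)"
      unfolding IKL using fin by (intro Pi_pmf_union) auto
    then show ?thesis
      by (simp only: pair_pmf_def map_pmf_def bind_assoc_pmf bind_return_pmf prod.case)
  qed
  have le: "measure_pmf.prob (map_pmf (?merge y) ?PL) ?Bad \<le> ?c" if y: "y \<in> set_pmf ?PK" for y
  proof -
    define x0 where "x0 = (SOME x. x \<in> X)"
    have x0: "x0 \<in> X" unfolding x0_def using ne by (simp add: some_in_eq)
    have "finite ?K" using fin by blast
    from subsetD[OF set_Pi_pmf_subset'[OF this] y] have "y \<in> PiE_dflt ?K dflt (set_pmf \<circ> (\<lambda>_. p))" .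
    then have yX: "y l \<in> X" if "l \<in> ?K" for l
      using that supp unfolding PiE_dflt_def o_def by blast
    define y' where "y' = (\<lambda>l. if l \<in> ?K then y l else x0)"
    have "y' \<in> ?I \<rightarrow> X" unfolding y'_def using x0 yX by (intro funcsetI) (simp only: split: if_split, blast)
    from avoid[OF this] obtain g where g: "g \<in> S" and "\<forall>l\<in>?I. y' l \<in> B g" by blast
    then have gB: "y (j, k) \<in> B g" if "j \<in> J" "k < m" for j k
      using J that unfolding y'_def by (metis (no_types, lifting) SigmaI lessThan_iff subsetD)
    have "?merge y -` ?Bad \<subseteq> (\<Union>i\<in>{..<n} - J. {z. \<forall>k<m. z (i, k) \<notin> A g})"
    proof
      fix z assume z: "z \<in> ?merge y -` ?Bad"
      have "\<forall>j\<in>J. \<forall>k<m. ?merge y z (j, k) \<in> B g" using gB by simp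
      then obtain i where "i \<in> {..<n} - J" "\<forall>k<m. ?merge y z (i, k) \<notin> A g"
        using z g(1) by blast
      then have "i \<in> {..<n} - J" "\<forall>k<m. z (i, k) \<notin> A g" by simp_all
      then show "z \<in> (\<Union>i\<in>{..<n} - J. {z. \<forall>k<m. z (i, k) \<notin> A g})" by blast
    qed
    then have "measure_pmf.prob ?PL (?merge y -` ?Bad)
        \<le> measure_pmf.prob ?PL (\<Union>i\<in>{..<n} - J. {z. \<forall>k<m. z (i, k) \<notin> A g})"
      by (intro measure_pmf.finite_measure_mono) auto
    also have "\<dots> \<le> (\<Sum>i\<in>{..<n} - J. measure_pmf.prob ?PL {z. \<forall>k<m. z (i, k) \<notin> A g})"
      by (intro measure_pmf.finite_measure_subadditive_finite) auto
    also have "\<dots> \<le> (\<Sum>i\<in>{..<n} - J. (1 - \<epsilon>) ^ m)"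
      using A[OF g(1)] by (intro sum_mono prob_block_misses_le) auto
    also have "\<dots> \<le> ?c"
      using card_mono[of "{..<n}" "{..<n} - J"] \<open>\<epsilon> \<le> 1\<close> by (simp add: mult_right_mono)
    finally show ?thesis by simp
  qed
  have "emeasure ?P ?Bad = (\<integral>\<^sup>+ y. emeasure (map_pmf (?merge y) ?PL) ?Bad \<partial>?PK)"
    unfolding P by (rule emeasure_bind_pmf)
  also have "\<dots> \<le> (\<integral>\<^sup>+ y. ennreal ?c \<partial>?PK)"
    using le by (intro nn_integral_mono_AE)
      (auto simp: AE_measure_pmf_iff measure_pmf.emeasure_eq_measure intro!: ennreal_leI simp del: measure_map_pmf)
  also have "\<dots> = ennreal ?c" by simp
  finally show ?thesis using c0 by (simp add: measure_pmf.emeasure_eq_measure)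
qed

text \<open>
The union bound over all \<open>2 ^ n\<close> patterns \<open>J\<close> yields one sample on which all of them are realised.
\<close>

lemma exists_blocks_all_patterns:
  fixes p :: "'x pmf" and A B :: "'g \<Rightarrow> 'x set" and n m :: nat and \<epsilon> :: real
  assumes supp: "set_pmf p \<subseteq> X"
    and A: "\<And>g. g \<in> S \<Longrightarrow> \<epsilon> \<le> measure_pmf.prob p (A g)"
    and avoid: "\<And>x. x \<in> {..<n} \<times> {..<m} \<rightarrow> X \<Longrightarrow> \<exists>g\<in>S. \<forall>l\<in>{..<n} \<times> {..<m}. x l \<in> B g"
    and small: "2 ^ n * (n * (1 - \<epsilon>) ^ m) < 1"
  shows "\<exists>x \<in> {..<n} \<times> {..<m} \<rightarrow> X. \<forall>J \<subseteq> {..<n}. \<exists>g\<in>S.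
     (\<forall>j\<in>J. \<forall>k<m. x (j, k) \<in> B g) \<and> (\<forall>i\<in>{..<n} - J. \<exists>k<m. x (i, k) \<in> A g)"
proof -
  define P where "P = Pi_pmf ({..<n} \<times> {..<m}) undefined (\<lambda>_. p)"
  define Bad where "Bad J = {x. \<not> (\<exists>g\<in>S. (\<forall>j\<in>J. \<forall>k<m. x (j, k) \<in> B g) \<and>
     (\<forall>i\<in>{..<n} - J. \<exists>k<m. x (i, k) \<in> A g))}" for J
  have "measure_pmf.prob P (\<Union>J\<in>Pow {..<n}. Bad J) \<le> (\<Sum>J\<in>Pow {..<n}. measure_pmf.prob P (Bad J))"
    by (intro measure_pmf.finite_measure_subadditive_finite) auto
  also have "\<dots> \<le> (\<Sum>J\<in>Pow {..<n}. n * (1 - \<epsilon>) ^ m)"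
    unfolding P_def Bad_def using supp A avoid by (intro sum_mono prob_bad_pattern_le) auto
  also have "\<dots> < 1" using small by (simp add: card_Pow)
  finally have "measure_pmf.prob P (\<Union>J\<in>Pow {..<n}. Bad J) \<noteq> 1" by simp
  then have "\<not> set_pmf P \<subseteq> (\<Union>J\<in>Pow {..<n}. Bad J)"
    using measure_pmf.prob_eq_1[of "\<Union>J\<in>Pow {..<n}. Bad J" P]
    by (simp only: sets_measure_pmf UNIV_I AE_measure_pmf_iff) blast
  then obtain x where x: "x \<in> set_pmf P" "\<And>J. J \<subseteq> {..<n} \<Longrightarrow> x \<notin> Bad J" by blast
  have "x \<in> PiE_dflt ({..<n} \<times> {..<m}) undefined (set_pmf \<circ> (\<lambda>_. p))"
    using x(1) unfolding P_def by (intro subsetD[OF set_Pi_pmf_subset']) simp_all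
  then have "x \<in> {..<n} \<times> {..<m} \<rightarrow> X"
    using supp unfolding PiE_dflt_def o_def by blast
  then show ?thesis using x(2) unfolding Bad_def by blast
qed

section \<open>Regular Borel probability measures\<close>

lemma space_borel_measure_of [simp]: "space (borel_measure_of X) = topspace X"
  unfolding borel_measure_of_def by (rule space_measure_of) (auto dest: openin_subset)

lemma sets_borel_measure_of_open: "openin X U \<Longrightarrow> U \<in> sets (borel_measure_of X)"
  unfolding borel_measure_of_def by (subst sets_measure_of) (auto dest: openin_subset)

lemma sets_borel_measure_of_closed: "closedin X C \<Longrightarrow> C \<in> sets (borel_measure_of X)"
proof -
  assume C: "closedin X C"
  then have "openin X (topspace X - C)" by blast
  then have "topspace X - (topspace X - C) \<in> sets (borel_measure_of X)"
    using sets.compl_sets[OF sets_borel_measure_of_open] by fastforce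
  moreover have "topspace X - (topspace X - C) = C" using closedin_subset[OF C] by blast
  ultimately show ?thesis by simp
qed

lemma continuous_map_measurable_borel_measure_of:
  "continuous_map X Y f \<Longrightarrow> f \<in> measurable (borel_measure_of X) (borel_measure_of Y)"
proof -
  assume f: "continuous_map X Y f"
  show ?thesis
    unfolding borel_measure_of_def[of Y]
  proof (rule measurable_measure_of)
    show "{U. openin Y U} \<subseteq> Pow (topspace Y)" by (auto dest: openin_subset)
    show "f \<in> space (borel_measure_of X) \<rightarrow> topspace Y"
      using f by (auto simp: continuous_map_def)
    fix U assume "U \<in> {U. openin Y U}"
    then have "openin X {x \<in> topspace X. f x \<in> U}"
      using f by (auto intro: openin_continuous_map_preimage)
    moreover have "f -` U \<inter> space (borel_measure_of X) = {x \<in> topspace X. f x \<in> U}" by auto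
    ultimately show "f -` U \<inter> space (borel_measure_of X) \<in> sets (borel_measure_of X)"
      using sets_borel_measure_of_open by metis
  qed
qed

lemma continuous_map_borel_measurable:
  "continuous_map X euclideanreal f \<Longrightarrow> f \<in> borel_measurable (borel_measure_of X)"
proof (rule borel_measurableI)
  fix S :: "real set" assume f: "continuous_map X euclideanreal f" and "open S"
  then have "openin X {x \<in> topspace X. f x \<in> S}"
    by (intro openin_continuous_map_preimage[OF f]) simp
  moreover have "f -` S \<inter> space (borel_measure_of X) = {x \<in> topspace X. f x \<in> S}" by auto
  ultimately show "f -` S \<inter> space (borel_measure_of X) \<in> sets (borel_measure_of X)"
    using sets_borel_measure_of_open by metis
qed

lemma ProbD:
  assumes "\<mu> \<in> Prob X"
  shows "prob_space \<mu>" "sets \<mu> = sets (borel_measure_of X)" "space \<mu> = topspace X"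
  using assms sets_eq_imp_space_eq[of \<mu> "borel_measure_of X"] by (auto simp: Prob_def)

lemma continuous_map_bounded:
  assumes "compact_space X" "continuous_map X euclideanreal f"
  shows "\<exists>C>0. \<forall>x\<in>topspace X. \<bar>f x\<bar> \<le> C"
proof -
  have "compactin euclideanreal (f ` topspace X)"
    using assms by (intro image_compactin[of X]) (auto simp: compact_space_def)
  then have "bounded (f ` topspace X)" by (simp add: compact_imp_bounded)
  then show ?thesis unfolding bounded_pos by auto
qed

lemma continuous_map_integrable:
  assumes "compact_space X" "\<mu> \<in> Prob X" "continuous_map X euclideanreal f"
  shows "integrable \<mu> f"
proof -
  interpret prob_space \<mu> using ProbD(1)[OF assms(2)] .
  obtain C where "\<forall>x\<in>topspace X. \<bar>f x\<bar> \<le> C" using continuous_map_bounded[OF assms(1,3)] by blast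
  then have "AE x in \<mu>. norm (f x) \<le> C" using ProbD(3)[OF assms(2)] by auto
  moreover have "f \<in> borel_measurable \<mu>"
    using continuous_map_borel_measurable[OF assms(3)] measurable_cong_sets[OF ProbD(2)[OF assms(2)] refl] by blast
  ultimately show ?thesis by (rule integrable_const_bound)
qed

text \<open>
Finite sets are closed in a Hausdorff space, hence \<open>A\<close> can be replaced from inside by the compact set
\<open>A \<inter> F\<close> and from outside by the open complement of \<open>F - A\<close>, which change it by a null set.
\<close>

lemma finitely_supported_in_Prob:
  assumes X: "Hausdorff_space X" and \<mu>: "prob_space \<mu>" "sets \<mu> = sets (borel_measure_of X)"
    and F: "finite F" "F \<subseteq> topspace X" "AE x in \<mu>. x \<in> F"
  shows "\<mu> \<in> Prob X"
proof -
  have sp: "space \<mu> = topspace X" using sets_eq_imp_space_eq[OF \<mu>(2)] by simp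
  have closed: "closedin X E" if "E \<subseteq> F" for E
    using closedin_Hausdorff_finite[OF X] that F finite_subset[OF that] by blast
  have "emeasure \<mu> A = (SUP K \<in> {K. K \<subseteq> A \<and> compactin X K}. emeasure \<mu> K)"
    (is "_ = ?S") if A: "A \<in> sets \<mu>" for A
  proof (rule antisym)
    have "A \<inter> F \<in> sets \<mu>" using closed[of "A \<inter> F"] sets_borel_measure_of_closed \<mu>(2) by auto
    then have "emeasure \<mu> A = emeasure \<mu> (A \<inter> F)"
      using A F(3) by (intro emeasure_eq_AE) auto
    also have "\<dots> \<le> ?S"
      using F by (intro SUP_upper CollectI conjI finite_imp_compactin) auto
    finally show "emeasure \<mu> A \<le> ?S" .
    show "?S \<le> emeasure \<mu> A" using A by (intro SUP_least emeasure_mono) auto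
  qed
  moreover have "emeasure \<mu> A = (INF U \<in> {U. A \<subseteq> U \<and> openin X U}. emeasure \<mu> U)"
    (is "_ = ?I") if A: "A \<in> sets \<mu>" for A
  proof (rule antisym)
    let ?U = "topspace X - (F - A)"
    have op: "openin X ?U" using closed[of "F - A"] by blast
    have "?I \<le> emeasure \<mu> ?U"
      using op sets.sets_into_space[OF A] sp by (intro INF_lower) auto
    also have "\<dots> = emeasure \<mu> A"
      using A F(2,3) sets_borel_measure_of_open[OF op] \<mu>(2) by (intro emeasure_eq_AE) auto
    finally show "?I \<le> emeasure \<mu> A" .
    show "emeasure \<mu> A \<le> ?I"
      using sets_borel_measure_of_open \<mu>(2) by (intro INF_greatest emeasure_mono) auto
  qed
  ultimately show ?thesis using \<mu> by (simp add: Prob_def)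
qed

lemma return_in_Prob:
  assumes "Hausdorff_space X" "x \<in> topspace X"
  shows "return (borel_measure_of X) x \<in> Prob X"
proof (rule finitely_supported_in_Prob[OF assms(1)])
  show "prob_space (return (borel_measure_of X) x)" using assms(2) by (intro prob_space_return) simp
  have "{x} \<in> sets (borel_measure_of X)"
    using closedin_Hausdorff_finite[OF assms(1), of "{x}"] assms(2) sets_borel_measure_of_closed by auto
  then show "AE y in return (borel_measure_of X) x. y \<in> {x}"
    using assms(2) by (subst AE_return) auto
qed (use assms(2) in auto)

lemma homeomorphic_map_distr_in_Prob:
  assumes X: "Hausdorff_space X" and \<phi>: "homeomorphic_map X X \<phi>" and \<mu>: "\<mu> \<in> Prob X"
  shows "distr \<mu> (borel_measure_of X) \<phi> \<in> Prob X"
proof -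
  let ?\<nu> = "distr \<mu> (borel_measure_of X) \<phi>"
  interpret prob_space \<mu> using ProbD(1)[OF \<mu>] .
  note S = ProbD(2)[OF \<mu>] and sp = ProbD(3)[OF \<mu>]
  have inj: "inj_on \<phi> (topspace X)" and onto: "\<phi> ` topspace X = topspace X"
    and cont: "continuous_map X X \<phi>" and om: "open_map X X \<phi>"
    using \<phi> by (auto simp: homeomorphic_eq_everything_map)
  have meas: "\<phi> \<in> measurable \<mu> (borel_measure_of X)"
    using continuous_map_measurable_borel_measure_of[OF cont] measurable_cong_sets[OF S refl] by blast
  have em: "emeasure ?\<nu> A = emeasure \<mu> {x \<in> topspace X. \<phi> x \<in> A}" if "A \<in> sets (borel_measure_of X)" for A
  proof -
    have "\<phi> -` A \<inter> space \<mu> = {x \<in> topspace X. \<phi> x \<in> A}" using sp by auto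
    then show ?thesis using emeasure_distr[OF meas that] by simp
  qed
  have pre: "{x \<in> topspace X. \<phi> x \<in> A} \<in> sets \<mu>" if "A \<in> sets (borel_measure_of X)" for A
  proof -
    have "\<phi> -` A \<inter> space \<mu> = {x \<in> topspace X. \<phi> x \<in> A}" using sp by auto
    then show ?thesis using measurable_sets[OF meas that] by simp
  qed
  have im: "{x \<in> topspace X. \<phi> x \<in> \<phi> ` K} = K" if "K \<subseteq> topspace X" for K
    using that inj by (auto dest: inj_onD)
  have compact_meas: "K \<in> sets (borel_measure_of X)" if "compactin X K" for K
    using compactin_imp_closedin[OF X that] by (rule sets_borel_measure_of_closed)
  have reg: "emeasure \<mu> A = (SUP K \<in> {K. K \<subseteq> A \<and> compactin X K}. emeasure \<mu> K)"
     "emeasure \<mu> A = (INF U \<in> {U. A \<subseteq> U \<and> openin X U}. emeasure \<mu> U)" if "A \<in> sets \<mu>" for A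
    using \<mu> that unfolding Prob_def by blast+
  have "emeasure ?\<nu> A = (SUP K \<in> {K. K \<subseteq> A \<and> compactin X K}. emeasure ?\<nu> K)"
    (is "_ = ?S") if A: "A \<in> sets (borel_measure_of X)" for A
  proof (rule antisym)
    show "?S \<le> emeasure ?\<nu> A" using A by (intro SUP_least emeasure_mono) auto
    have "emeasure \<mu> K \<le> ?S" if K: "K \<subseteq> {x \<in> topspace X. \<phi> x \<in> A}" "compactin X K" for K
    proof -
      have c: "compactin X (\<phi> ` K)" by (rule image_compactin[OF K(2) cont])
      have "K \<subseteq> topspace X" using K(1) by blast
      then have "emeasure \<mu> K = emeasure ?\<nu> (\<phi> ` K)" using em[OF compact_meas[OF c]] im by simp
      also have "\<dots> \<le> ?S" using K(1) c by (intro SUP_upper) auto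
      finally show ?thesis .
    qed
    then show "emeasure ?\<nu> A \<le> ?S"
      unfolding em[OF A] reg(1)[OF pre[OF A]] by (intro SUP_least) auto
  qed
  moreover have "emeasure ?\<nu> A = (INF U \<in> {U. A \<subseteq> U \<and> openin X U}. emeasure ?\<nu> U)"
    (is "_ = ?I") if A: "A \<in> sets (borel_measure_of X)" for A
  proof (rule antisym)
    show "emeasure ?\<nu> A \<le> ?I"
      using sets_borel_measure_of_open by (intro INF_greatest emeasure_mono) auto
    have "?I \<le> emeasure \<mu> U" if U: "{x \<in> topspace X. \<phi> x \<in> A} \<subseteq> U" "openin X U" for U
    proof -
      have o: "openin X (\<phi> ` U)" using om U(2) by (simp add: open_map_def)
      have "A \<subseteq> topspace X" using sets.sets_into_space[OF A] by simp
      have "A \<subseteq> \<phi> ` U"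
      proof
        fix a assume "a \<in> A"
        then obtain x where "x \<in> topspace X" "a = \<phi> x"
          using \<open>A \<subseteq> topspace X\<close> onto by auto
        then show "a \<in> \<phi> ` U" using U(1) \<open>a \<in> A\<close> by auto
      qed
      then have "?I \<le> emeasure ?\<nu> (\<phi> ` U)" using o by (intro INF_lower) auto
      also have "\<dots> = emeasure \<mu> U"
        using em[OF sets_borel_measure_of_open[OF o]] im[OF openin_subset[OF U(2)]] by simp
      finally show ?thesis .
    qed
    then show "?I \<le> emeasure ?\<nu> A"
      unfolding em[OF A] reg(2)[OF pre[OF A]] by (intro INF_greatest) auto
  qed
  ultimately show ?thesis using prob_space_distr[OF meas] by (simp add: Prob_def)
qed

text \<open>
A basic weak-* neighbourhood of the Dirac measure at \<open>z\<close> constrains the integrals of finitely many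
continuous functions \<open>f\<close>. All of these integrals are controlled by the integral of the single
nonnegative function \<open>F\<close> with \<open>F x = (\<Sum>f. \<bar>f x - f z\<bar>)\<close>, which vanishes at \<open>z\<close>.
\<close>

lemma return_in_closure_of_orbit:
  fixes \<alpha> :: "'g \<Rightarrow> 'x \<Rightarrow> 'x"
  assumes X: "compact_space X" "Hausdorff_space X"
    and \<alpha>: "\<And>g. g \<in> S \<Longrightarrow> homeomorphic_map X X (\<alpha> g)"
    and \<mu>: "\<mu> \<in> Prob X" and z: "z \<in> topspace X"
    and conc: "\<And>F \<epsilon>. continuous_map X euclideanreal F \<Longrightarrow> (\<And>x. x \<in> topspace X \<Longrightarrow> 0 \<le> F x) \<Longrightarrow>
      F z = 0 \<Longrightarrow> 0 < \<epsilon> \<Longrightarrow> \<exists>g\<in>S. (\<integral>x. F (\<alpha> g x) \<partial>\<mu>) < \<epsilon>"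
  shows "return (borel_measure_of X) z \<in>
    weak_star X closure_of ((\<lambda>g. distr \<mu> (borel_measure_of X) (\<alpha> g)) ` S)"
proof -
  let ?ev = "\<lambda>\<mu>. \<lambda>f \<in> cont_funs X. integral\<^sup>L \<mu> f"
  let ?P = "product_topology (\<lambda>_. euclideanreal) (cont_funs X)"
  let ?r = "return (borel_measure_of X) z"
  have ev_top: "?ev \<nu> \<in> topspace ?P" for \<nu> by auto
  have top: "?r \<in> topspace (weak_star X)"
    unfolding weak_star_def topspace_pullback_topology using ev_top return_in_Prob[OF X(2) z] by auto
  have "\<exists>y \<in> (\<lambda>g. distr \<mu> (borel_measure_of X) (\<alpha> g)) ` S. y \<in> W"
    if W: "?r \<in> W" "openin (weak_star X) W" for W
  proof -
    obtain O' where O': "openin ?P O'" "W = ?ev -` O' \<inter> Prob X"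
      using W(2) unfolding weak_star_def openin_pullback_topology by blast
    have "?ev ?r \<in> O'" using W(1) O'(2) by blast
    then obtain U where U: "finite {f \<in> cont_funs X. U f \<noteq> topspace euclideanreal}"
        "\<forall>f \<in> cont_funs X. openin euclideanreal (U f)" "?ev ?r \<in> Pi\<^sub>E (cont_funs X) U"
        "Pi\<^sub>E (cont_funs X) U \<subseteq> O'"
      using O'(1) unfolding openin_product_topology_alt by blast
    define J where "J = {f \<in> cont_funs X. U f \<noteq> UNIV}"
    have J: "finite J" "J \<subseteq> cont_funs X" using U(1) by (auto simp: J_def)
    have contJ: "continuous_map X euclideanreal f" if "f \<in> J" for f
      using J(2) that by (auto simp: cont_funs_def)
    have "\<exists>e>0. ball (f z) e \<subseteq> U f" if "f \<in> J" for f
    proof -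
      have "f \<in> borel_measurable (borel_measure_of X)"
        using contJ[OF that] by (rule continuous_map_borel_measurable)
      then have "integral\<^sup>L ?r f = f z" using z by (intro integral_return) auto
      moreover have "?ev ?r f \<in> U f" using U(3) J(2) that by blast
      ultimately have "f z \<in> U f" using J(2) that by auto
      moreover have "open (U f)" using U(2) J(2) that by auto
      ultimately show ?thesis using open_contains_ball by blast
    qed
    then obtain e where e: "\<And>f. f \<in> J \<Longrightarrow> 0 < e f" "\<And>f. f \<in> J \<Longrightarrow> ball (f z) (e f) \<subseteq> U f" by metis
    define \<epsilon> where "\<epsilon> = Min (insert 1 (e ` J))"
    have "0 < \<epsilon>" using J(1) e(1) by (auto simp: \<epsilon>_def)
    have \<epsilon>_le: "\<epsilon> \<le> e f" if "f \<in> J" for f using J(1) that by (auto simp: \<epsilon>_def)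
    define F where "F x = (\<Sum>f\<in>J. \<bar>f x - f z\<bar>)" for x
    have "continuous_map X euclideanreal F"
      unfolding F_def using J contJ
      by (intro continuous_map_sum continuous_map_real_abs continuous_map_diff) auto
    moreover have "0 \<le> F x" for x unfolding F_def by (intro sum_nonneg) auto
    moreover have "F z = 0" by (simp add: F_def)
    ultimately obtain g where g: "g \<in> S" "(\<integral>x. F (\<alpha> g x) \<partial>\<mu>) < \<epsilon>"
      using conc[of F \<epsilon>] \<open>0 < \<epsilon>\<close> by blast
    let ?\<nu> = "distr \<mu> (borel_measure_of X) (\<alpha> g)"
    interpret prob_space \<mu> using ProbD(1)[OF \<mu>] .
    have cont: "continuous_map X X (\<alpha> g)" using \<alpha>[OF g(1)] homeomorphic_imp_continuous_map by blast
    have meas: "\<alpha> g \<in> measurable \<mu> (borel_measure_of X)"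
      using continuous_map_measurable_borel_measure_of[OF cont] measurable_cong_sets[OF ProbD(2)[OF \<mu>] refl]
      by blast
    have int_comp: "integrable \<mu> (\<lambda>x. h (\<alpha> g x))" if "continuous_map X euclideanreal h" for h
      using continuous_map_integrable[OF X(1) \<mu>] continuous_map_compose[OF cont that] by (simp add: o_def)
    have "integral\<^sup>L ?\<nu> f \<in> U f" if "f \<in> J" for f
    proof -
      have "integral\<^sup>L ?\<nu> f = (\<integral>x. f (\<alpha> g x) \<partial>\<mu>)"
        using meas continuous_map_borel_measurable[OF contJ[OF that]] by (rule integral_distr)
      then have "integral\<^sup>L ?\<nu> f - f z = (\<integral>x. f (\<alpha> g x) - f z \<partial>\<mu>)"
        using int_comp[OF contJ[OF that]] by (simp add: prob_space)
      then have "\<bar>integral\<^sup>L ?\<nu> f - f z\<bar> \<le> (\<integral>x. \<bar>f (\<alpha> g x) - f z\<bar> \<partial>\<mu>)"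
        by simp
      also have "\<dots> \<le> (\<integral>x. F (\<alpha> g x) \<partial>\<mu>)"
      proof (rule integral_mono)
        show "integrable \<mu> (\<lambda>x. \<bar>f (\<alpha> g x) - f z\<bar>)"
          using int_comp[OF contJ[OF that]] by auto
        show "integrable \<mu> (\<lambda>x. F (\<alpha> g x))" by (rule int_comp) fact
        show "\<bar>f (\<alpha> g x) - f z\<bar> \<le> F (\<alpha> g x)" for x
          unfolding F_def using J(1) that
          by (intro member_le_sum[of f J "\<lambda>f. \<bar>f (\<alpha> g x) - f z\<bar>"]) auto
      qed
      also have "\<dots> < e f" using g(2) \<epsilon>_le[OF that] by simp
      finally have "integral\<^sup>L ?\<nu> f \<in> ball (f z) (e f)" by (simp add: dist_real_def abs_minus_commute)
      then show ?thesis using e(2)[OF that] by blast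
    qed
    moreover have "U f = UNIV" if "f \<in> cont_funs X - J" for f using that by (auto simp: J_def)
    ultimately have "?ev ?\<nu> \<in> Pi\<^sub>E (cont_funs X) U" by fastforce
    then have "?\<nu> \<in> W"
      using U(4) O'(2) homeomorphic_map_distr_in_Prob[OF X(2) \<alpha>[OF g(1)] \<mu>] by blast
    then show ?thesis using g(1) by blast
  qed
  then show ?thesis using top unfolding in_closure_of by blast
qed

section \<open>A net theorem for families with a gap\<close>

text \<open>
Choose one point in each nonempty atom of the finite algebra generated by the sets \<open>A g\<close> and give it
the mass of its atom.
\<close>

lemma exists_finite_pmf_agreeing:
  assumes "prob_space \<mu>" "finite S" and A: "\<And>g. g \<in> S \<Longrightarrow> A g \<in> sets \<mu>"
  shows "\<exists>p. set_pmf p \<subseteq> space \<mu> \<and> (\<forall>g\<in>S. measure_pmf.prob p (A g) = measure \<mu> (A g))"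
proof -
  interpret prob_space \<mu> by fact
  define \<tau> where "\<tau> x = {g \<in> S. x \<in> A g}" for x
  \<comment> \<open>\<open>\<tau> x\<close> names the atom that contains \<open>x\<close>, and \<open>r\<close> maps every atom to its chosen point.\<close>
  define r where "r x = (SOME y. y \<in> space \<mu> \<and> \<tau> y = \<tau> x)" for x
  have r: "r x \<in> space \<mu>" "\<tau> (r x) = \<tau> x" if "x \<in> space \<mu>" for x
    using someI[of "\<lambda>y. y \<in> space \<mu> \<and> \<tau> y = \<tau> x" x] that by (auto simp: r_def)
  have r_cong: "r x = r y" if "\<tau> x = \<tau> y" for x y using that by (simp add: r_def)
  have fin: "finite (r ` space \<mu>)"
  proof -
    have "finite (\<tau> ` space \<mu>)"
      by (rule finite_subset[of _ "Pow S"]) (use assms(2) in \<open>auto simp: \<tau>_def\<close>)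
    moreover have "r ` space \<mu> \<subseteq> (\<lambda>T. r (SOME x. \<tau> x = T)) ` \<tau> ` space \<mu>"
    proof
      fix y assume "y \<in> r ` space \<mu>"
      then obtain x where x: "x \<in> space \<mu>" "y = r x" by auto
      have "\<tau> (SOME x'. \<tau> x' = \<tau> x) = \<tau> x" by (rule someI[of _ x]) simp
      then have "y = r (SOME x'. \<tau> x' = \<tau> x)" using x r_cong by metis
      then show "y \<in> (\<lambda>T. r (SOME x. \<tau> x = T)) ` \<tau> ` space \<mu>" using x by blast
    qed
    ultimately show ?thesis using finite_subset by blast
  qed
  have "simple_function \<mu> r"
    unfolding simple_function_def
  proof (intro conjI ballI fin)
    fix y assume "y \<in> r ` space \<mu>"
    then obtain x' where x': "x' \<in> space \<mu>" "y = r x'" by auto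
    then have "\<tau> y = \<tau> x'" using r(2) by simp
    then have "r y = r x'" by (rule r_cong)
    with x'(2) have "r y = y" by (simp only:)
    have ry: "\<tau> x = \<tau> y \<longleftrightarrow> r x = y" if "x \<in> space \<mu>" for x
    proof
      show "r x = y" if "\<tau> x = \<tau> y" using r_cong[OF that] \<open>r y = y\<close> by simp
      show "\<tau> x = \<tau> y" if "r x = y" using r(2)[OF \<open>x \<in> space \<mu>\<close>] that by simp
    qed
    have "r -` {y} \<inter> space \<mu> = {x \<in> space \<mu>. \<forall>g\<in>S. (x \<in> A g) = (y \<in> A g)}"
      using ry by (auto simp: \<tau>_def set_eq_iff)
    also have "\<dots> \<in> sets \<mu>"
      using A assms(2) by (intro sets.sets_Collect_finite_All) auto
    finally show "r -` {y} \<inter> space \<mu> \<in> sets \<mu>" .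
  qed
  then have meas: "r \<in> measurable \<mu> (count_space UNIV)" by (rule measurable_simple_function)
  define N where "N = distr \<mu> (count_space UNIV) r"
  interpret N: prob_space N unfolding N_def using meas by (rule prob_space_distr)
  have "AE x in N. x \<in> r ` space \<mu>"
    unfolding N_def using meas by (subst AE_distr_iff) auto
  then have "AE x in N. measure N {x} \<noteq> 0"
    using fin N.AE_support_countable by (auto simp: N_def intro!: exI[of _ "r ` space \<mu>"] countable_finite)
  moreover have "sets N = UNIV" by (simp add: N_def)
  ultimately have pN: "measure_pmf (Abs_pmf N) = N"
    using N.prob_space_axioms by (intro Abs_pmf_inverse CollectI conjI)
  have "set_pmf (Abs_pmf N) \<subseteq> space \<mu>"
  proof -
    have "AE x in measure_pmf (Abs_pmf N). x \<in> r ` space \<mu>"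
      unfolding pN by fact
    then show ?thesis using r by (auto simp: AE_measure_pmf_iff)
  qed
  moreover have "measure_pmf.prob (Abs_pmf N) (A g) = measure \<mu> (A g)" if "g \<in> S" for g
  proof -
    have "r -` A g \<inter> space \<mu> = A g"
      using r(2) that sets.sets_into_space[OF A[OF that]] by (auto simp: \<tau>_def set_eq_iff)
    then show ?thesis unfolding pN unfolding N_def using meas by (subst measure_distr) auto
  qed
  ultimately show ?thesis by blast
qed

text \<open>
The tuples that lie in \<open>B g\<close> form an open box, and the boxes cover the compact power of \<open>X\<close> by
assumption; a finite subcover remains.
\<close>

lemma compact_avoidance_finite:
  fixes B :: "'g \<Rightarrow> 'x set"
  assumes "compact_space X" "\<And>g. g \<in> S \<Longrightarrow> openin X (B g)"
    and avoid: "\<And>x. x \<in> I \<rightarrow> topspace X \<Longrightarrow> \<exists>g\<in>S. \<forall>i\<in>I. x i \<in> B g" and "finite I"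
  shows "\<exists>S' \<subseteq> S. finite S' \<and> (\<forall>x \<in> I \<rightarrow> topspace X. \<exists>g\<in>S'. \<forall>i\<in>I. x i \<in> B g)"
proof -
  let ?P = "product_topology (\<lambda>_. X) I" and ?box = "\<lambda>g. PiE I (\<lambda>_. B g)"
  have "compactin ?P (topspace ?P)"
    using assms(1) by (subst compact_space_def[symmetric]) (simp add: compact_space_product_topology)
  moreover have "openin ?P U" if "U \<in> ?box ` S" for U
    using that assms(2,4) by (auto simp: openin_PiE)
  moreover have "topspace ?P \<subseteq> \<Union>(?box ` S)"
  proof
    fix x assume x: "x \<in> topspace ?P"
    then obtain g where "g \<in> S" "\<forall>i\<in>I. x i \<in> B g" using avoid[of x] by auto
    then show "x \<in> \<Union>(?box ` S)" using x by (auto simp: PiE_iff)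
  qed
  ultimately obtain \<F> where \<F>: "finite \<F>" "\<F> \<subseteq> ?box ` S" "topspace ?P \<subseteq> \<Union>\<F>"
    using compactinD by metis
  then obtain S' where S': "S' \<subseteq> S" "finite S'" "\<F> = ?box ` S'"
    using finite_subset_image by metis
  have "\<exists>g\<in>S'. \<forall>i\<in>I. x i \<in> B g" if "x \<in> I \<rightarrow> topspace X" for x
  proof -
    have "restrict x I \<in> topspace ?P" using that by auto
    then obtain g where "g \<in> S'" "restrict x I \<in> ?box g" using \<F>(3) S'(3) by blast
    then show ?thesis by (intro bexI[of _ g]) (auto simp: PiE_iff)
  qed
  then show ?thesis using S' by blast
qed

lemma exists_quartering_power:
  fixes \<epsilon> :: real
  assumes "0 < \<epsilon>" "\<epsilon> \<le> 1"
  shows "\<exists>c. (1 - \<epsilon>) ^ c \<le> 1 / 4"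
  using assms real_arch_pow_inv[of "1/4" "1 - \<epsilon>"] by (auto intro: less_imp_le)

text \<open>
This is an \<open>\<epsilon>\<close>-net theorem for a family of functions that are given up to a gap: \<open>R g\<close> is forced to hold
where the dense map \<open>orb\<close> takes values in \<open>A g\<close> and to fail where it takes values in \<open>B g\<close>, and it is
arbitrary elsewhere. If every \<open>A g\<close> has measure at least \<open>\<epsilon>\<close> and nevertheless every finite set is
contained in some \<open>B g\<close>, then no finite set is a net for the sets \<open>A g\<close>, and the dimension of
the family must be infinite.

By compactness finitely many indices \<open>g\<close> suffice for all tuples of the sample size, and for these the
measure can be replaced by a discrete one. Sampling \<open>n\<close> blocks of \<open>n * c\<close> points then realises all
\<open>2 ^ n\<close> patterns of blocks inside \<open>B g\<close> and blocks that meet \<open>A g\<close>. The patterns involve finitely many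
open conditions, so the sample points can be moved into the range of \<open>orb\<close>, where different patterns
leave different traces. As the sample has polynomial size in \<open>n\<close>, the Sauer-Shelah lemma applies.
\<close>

proposition large_evading_family_shatters:
  fixes A B :: "'g \<Rightarrow> 'x set" and orb :: "'h \<Rightarrow> 'x" and R :: "'g \<Rightarrow> 'h \<Rightarrow> bool" and \<epsilon> :: real
  assumes X: "compact_space X"
    and \<mu>: "prob_space \<mu>" "sets \<mu> = sets (borel_measure_of X)"
    and op: "\<And>g. g \<in> S \<Longrightarrow> openin X (A g)" "\<And>g. g \<in> S \<Longrightarrow> openin X (B g)"
    and large: "\<And>g. g \<in> S \<Longrightarrow> \<epsilon> \<le> measure \<mu> (A g)" "0 < \<epsilon>"
    and evade: "\<And>F. finite F \<Longrightarrow> F \<subseteq> topspace X \<Longrightarrow> \<exists>g\<in>S. F \<subseteq> B g"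
    and dense: "\<And>V. openin X V \<Longrightarrow> V \<noteq> {} \<Longrightarrow> \<exists>h\<in>H. orb h \<in> V"
    and sep: "\<And>g h. g \<in> S \<Longrightarrow> h \<in> H \<Longrightarrow> orb h \<in> A g \<Longrightarrow> R g h"
      "\<And>g h. g \<in> S \<Longrightarrow> h \<in> H \<Longrightarrow> orb h \<in> B g \<Longrightarrow> \<not> R g h"
  shows "\<exists>U \<subseteq> H. finite U \<and> card U = d \<and> traces_shatter ((\<lambda>g. {h \<in> H. R g h}) ` S) U"
proof -
  obtain g0 where "g0 \<in> S" using evade[of "{}"] by auto
  then have "\<epsilon> \<le> 1" using large(1)[of g0] prob_space.prob_le_1[OF \<mu>(1), of "A g0"] by linarith
  \<comment> \<open>With \<open>n * c\<close> points in a block, a fixed block misses a set of measure \<open>\<epsilon>\<close> with probability at most \<open>4 ^ -n\<close>.\<close>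
  then obtain c where c: "(1 - \<epsilon>) ^ c \<le> 1 / 4" using exists_quartering_power large(2) by blast
  obtain n where n: "n \<ge> 1" "(n * (n * c) + 1) ^ d < 2 ^ n" using polynomial_less_two_power by blast
  let ?m = "n * c"
  let ?I = "{..<n} \<times> {..<?m}"
  have spX: "space \<mu> = topspace X" using sets_eq_imp_space_eq[OF \<mu>(2)] by simp
  have small: "2 ^ n * (n * (1 - \<epsilon>) ^ ?m) < 1"
  proof -
    have "(1 - \<epsilon>) ^ ?m = ((1 - \<epsilon>) ^ c) ^ n" by (simp add: mult.commute power_mult)
    also have "\<dots> \<le> (1 / 4) ^ n" using c \<open>\<epsilon> \<le> 1\<close> by (intro power_mono) auto
    finally have "2 ^ n * (n * (1 - \<epsilon>) ^ ?m) \<le> 2 ^ n * (n * (1 / 4) ^ n)"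
      by (intro mult_left_mono) auto
    also have "\<dots> = n / 2 ^ n"
    proof -
      have "(4::real) ^ n = 2 ^ n * 2 ^ n" by (simp flip: power_mult_distrib)
      then show ?thesis by (simp add: power_divide)
    qed
    also have "\<dots> < 1" using of_nat_less_two_power[of n, where 'a = real] by simp
    finally show ?thesis .
  qed
  have avoid: "\<exists>g\<in>S. \<forall>i\<in>?I. x i \<in> B g" if "x \<in> ?I \<rightarrow> topspace X" for x
  proof -
    have "x ` ?I \<subseteq> topspace X" using that by blast
    then obtain g where "g \<in> S" "x ` ?I \<subseteq> B g" using evade[of "x ` ?I"] by auto
    then show ?thesis by blast
  qed
  obtain S' where S': "S' \<subseteq> S" "finite S'"
    and avoid': "\<And>x. x \<in> ?I \<rightarrow> topspace X \<Longrightarrow> \<exists>g\<in>S'. \<forall>i\<in>?I. x i \<in> B g"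
    using compact_avoidance_finite[OF X op(2) avoid] by auto
  have meas: "A g \<in> sets \<mu>" if "g \<in> S'" for g
    using that S'(1) op(1)[of g] \<mu>(2) sets_borel_measure_of_open by blast
  obtain p where p: "set_pmf p \<subseteq> topspace X" "\<And>g. g \<in> S' \<Longrightarrow> measure_pmf.prob p (A g) = measure \<mu> (A g)"
    using exists_finite_pmf_agreeing[of \<mu> S' A, OF \<mu>(1) S'(2) meas] spX by metis
  have "\<epsilon> \<le> measure_pmf.prob p (A g)" if "g \<in> S'" for g
    using p(2)[OF that] large(1) S'(1) that by auto
  from exists_blocks_all_patterns[of p "topspace X" S' \<epsilon> A n ?m B, OF p(1) this avoid' small]
  obtain x where x: "x \<in> ?I \<rightarrow> topspace X" and "\<forall>J \<subseteq> {..<n}. \<exists>g\<in>S'.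
     (\<forall>j\<in>J. \<forall>k<?m. x (j, k) \<in> B g) \<and> (\<forall>i\<in>{..<n} - J. \<exists>k<?m. x (i, k) \<in> A g)"
    by blast
  then have "\<forall>J. \<exists>g. J \<subseteq> {..<n} \<longrightarrow> g \<in> S' \<and>
     (\<forall>j\<in>J. \<forall>k<?m. x (j, k) \<in> B g) \<and> (\<forall>i\<in>{..<n} - J. \<exists>k<?m. x (i, k) \<in> A g)"
    by blast
  from choice[OF this] obtain \<gamma> where pattern: "\<forall>J. J \<subseteq> {..<n} \<longrightarrow> \<gamma> J \<in> S' \<and>
     (\<forall>j\<in>J. \<forall>k<?m. x (j, k) \<in> B (\<gamma> J)) \<and> (\<forall>i\<in>{..<n} - J. \<exists>k<?m. x (i, k) \<in> A (\<gamma> J))"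
    by (rule exE)
  have \<gamma>: "\<And>J. J \<subseteq> {..<n} \<Longrightarrow> \<gamma> J \<in> S"
     "\<And>J j k. J \<subseteq> {..<n} \<Longrightarrow> j \<in> J \<Longrightarrow> k < ?m \<Longrightarrow> x (j, k) \<in> B (\<gamma> J)"
     "\<And>J i. J \<subseteq> {..<n} \<Longrightarrow> i \<in> {..<n} - J \<Longrightarrow> \<exists>k<?m. x (i, k) \<in> A (\<gamma> J)"
    using S'(1) by (auto dest: pattern[rule_format])
  \<comment> \<open>The points of \<open>V l\<close> satisfy all conditions that \<open>x l\<close> satisfies in any of the patterns.\<close>
  define V where "V l = topspace X \<inter> \<Inter>((A \<circ> \<gamma>) ` {J. J \<subseteq> {..<n} \<and> x l \<in> A (\<gamma> J)}) \<inter>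
     \<Inter>((B \<circ> \<gamma>) ` {J. J \<subseteq> {..<n} \<and> x l \<in> B (\<gamma> J)})" for l
  have fin: "finite {J. J \<subseteq> {..<n} \<and> P J}" for P :: "nat set \<Rightarrow> bool"
    by (rule finite_subset[of _ "Pow {..<n}"]) auto
  have "\<exists>h\<in>H. orb h \<in> V l" if "l \<in> ?I" for l
  proof (rule dense)
    show "openin X (V l)"
      unfolding V_def using op \<gamma>(1) fin by (intro openin_Int_Inter openin_topspace) auto
    show "V l \<noteq> {}" using x that unfolding V_def by (auto simp: Pi_iff)
  qed
  then obtain u where u: "\<And>l. l \<in> ?I \<Longrightarrow> u l \<in> H" "\<And>l. l \<in> ?I \<Longrightarrow> orb (u l) \<in> V l" by metis
  let ?U = "u ` ?I"
  define T where "T J = {h \<in> ?U. R (\<gamma> J) h}" for J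
  have inA: "u l \<in> T J" if "l \<in> ?I" "J \<subseteq> {..<n}" "x l \<in> A (\<gamma> J)" for l J
  proof -
    have "orb (u l) \<in> A (\<gamma> J)" using u(2)[OF that(1)] that(2,3) unfolding V_def by auto
    then show ?thesis using sep(1)[OF \<gamma>(1)[OF that(2)] u(1)[OF that(1)]] that(1) unfolding T_def by blast
  qed
  have inB: "u l \<notin> T J" if "l \<in> ?I" "J \<subseteq> {..<n}" "x l \<in> B (\<gamma> J)" for l J
  proof -
    have "orb (u l) \<in> B (\<gamma> J)" using u(2)[OF that(1)] that(2,3) unfolding V_def by auto
    then show ?thesis using sep(2)[OF \<gamma>(1)[OF that(2)] u(1)[OF that(1)]] unfolding T_def by blast
  qed
  have sub: "J' \<subseteq> J" if "J \<subseteq> {..<n}" "J' \<subseteq> {..<n}" "T J = T J'" for J J'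
  proof
    fix i assume i: "i \<in> J'"
    show "i \<in> J"
    proof (rule ccontr)
      assume "i \<notin> J"
      then have "i \<in> {..<n} - J" using that(2) i by blast
      from \<gamma>(3)[OF that(1) this] obtain k where k: "k < ?m" "x (i, k) \<in> A (\<gamma> J)" by blast
      have l: "(i, k) \<in> ?I" using that(2) i k by auto
      show False using inA[OF l that(1) k(2)] inB[OF l that(2) \<gamma>(2)[OF that(2) i k(1)]] that(3) by simp
    qed
  qed
  have "inj_on T (Pow {..<n})" using sub by (intro inj_onI) (simp add: subset_antisym)
  then have card_T: "card (T ` Pow {..<n}) = 2 ^ n" by (simp add: card_image card_Pow)
  have "card ?U \<le> n * ?m" using card_image_le[of ?I u] by simp
  then have "(card ?U + 1) ^ d \<le> (n * ?m + 1) ^ d" by (intro power_mono) auto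
  then have "(card ?U + 1) ^ d < card (T ` Pow {..<n})" using n(2) card_T by simp
  moreover have "T ` Pow {..<n} \<subseteq> Pow ?U" unfolding T_def by auto
  ultimately obtain W where W: "W \<subseteq> ?U" "card W = Suc d" "traces_shatter (T ` Pow {..<n}) W"
    using sauer_shelah[of ?U "T ` Pow {..<n}" d] by auto
  obtain U where U: "U \<subseteq> W" "card U = d" "finite U"
    using obtain_subset_with_card_n[of d W] W(2) by auto
  have "traces_shatter (T ` Pow {..<n}) U" using traces_shatter_subset[OF W(3) U(1)] .
  moreover have "T J \<inter> U = {h \<in> H. R (\<gamma> J) h} \<inter> U" for J
    using U(1) W(1) u(1) unfolding T_def by auto
  ultimately have "\<exists>J \<subseteq> {..<n}. {h \<in> H. R (\<gamma> J) h} \<inter> U = E" if "E \<subseteq> U" for E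
    using that unfolding traces_shatter_def by auto
  then have "traces_shatter ((\<lambda>g. {h \<in> H. R g h}) ` S) U"
    unfolding traces_shatter_def using \<gamma>(1) by (meson image_eqI)
  moreover have "U \<subseteq> H" using U(1) W(1) u(1) by blast
  ultimately show ?thesis using U by blast
qed

section \<open>Minimal proximal flows\<close>

locale compact_flow =
  fixes G :: "('g, 'm) monoid_scheme" (structure)
    and X :: "'x topology" and \<alpha> :: "'g \<Rightarrow> 'x \<Rightarrow> 'x"
  assumes flow: "flow G X \<alpha>"
begin

lemma nonempty: "topspace X \<noteq> {}"
  and compact: "compact_space X"
  and hausdorff: "Hausdorff_space X"
  and action: "group_action G (topspace X) \<alpha>"
  and homeo: "g \<in> carrier G \<Longrightarrow> homeomorphic_map X X (\<alpha> g)"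
  using flow by (auto simp: flow_def)

lemma grp: "group G"
  using group_action.group_hom[OF action] by (simp add: group_hom_def)

lemma act_in: "g \<in> carrier G \<Longrightarrow> x \<in> topspace X \<Longrightarrow> \<alpha> g x \<in> topspace X"
  using group_action.element_image[OF action] by blast

lemma act_mult:
  "g \<in> carrier G \<Longrightarrow> h \<in> carrier G \<Longrightarrow> x \<in> topspace X \<Longrightarrow> \<alpha> (g \<otimes> h) x = \<alpha> g (\<alpha> h x)"
  using group_action.composition_rule[OF action] by blast

lemma act_one: "x \<in> topspace X \<Longrightarrow> \<alpha> \<one> x = x"
  using group_action.id_eq_one[OF action] by (metis restrict_apply')

lemma act_cont: "g \<in> carrier G \<Longrightarrow> continuous_map X X (\<alpha> g)"
  using homeo homeomorphic_imp_continuous_map by blast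

lemma openin_translate:
  "g \<in> carrier G \<Longrightarrow> openin X U \<Longrightarrow> openin X {x \<in> topspace X. \<alpha> g x \<in> U}"
  using act_cont openin_continuous_map_preimage by blast

lemma mult_in: "g \<in> carrier G \<Longrightarrow> h \<in> carrier G \<Longrightarrow> g \<otimes> h \<in> carrier G"
  using grp by (simp add: group.is_monoid monoid.m_closed)

lemma one_in: "\<one> \<in> carrier G"
  using grp by (simp add: group.is_monoid monoid.one_closed)

text \<open>
The points whose orbit never enters \<open>U\<close> form a proper subflow, which is empty by minimality.
\<close>

lemma minimal_orbit_meets:
  assumes min: "minimal G X \<alpha>" and x: "x \<in> topspace X" and U: "openin X U" "U \<noteq> {}"
  shows "\<exists>g\<in>carrier G. \<alpha> g x \<in> U"
proof (rule ccontr)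
  assume never: "\<not> ?thesis"
  let ?V = "\<lambda>g. {y \<in> topspace X. \<alpha> g y \<in> U}"
  let ?Y = "topspace X - (\<Union>g\<in>carrier G. ?V g)"
  have "closedin X ?Y" using openin_translate U(1) by (intro closedin_diff openin_Union) auto
  moreover have "\<alpha> h y \<in> ?Y" if "h \<in> carrier G" "y \<in> ?Y" for h y
  proof -
    have y: "y \<in> topspace X" "\<And>g. g \<in> carrier G \<Longrightarrow> \<alpha> g y \<notin> U" using that(2) by auto
    have "\<alpha> g (\<alpha> h y) \<notin> U" if "g \<in> carrier G" for g
      using y(2)[of "g \<otimes> h"] act_mult[OF that \<open>h \<in> carrier G\<close> y(1)] mult_in[OF that \<open>h \<in> carrier G\<close>]
      by simp
    then show ?thesis using act_in[OF that(1) y(1)] by auto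
  qed
  ultimately have "subflow G X \<alpha> ?Y" by (auto simp: subflow_def)
  moreover have "x \<in> ?Y" using never x by auto
  ultimately have "?Y = topspace X" using min unfolding minimal_def by blast
  moreover obtain u where "u \<in> U" using U(2) by blast
  moreover have "u \<in> topspace X" using \<open>u \<in> U\<close> openin_subset[OF U(1)] by blast
  moreover have "u \<in> ?V \<one>" using act_one[of u] \<open>u \<in> U\<close> \<open>u \<in> topspace X\<close> by simp
  then have "u \<notin> ?Y" using one_in by blast
  ultimately show False by blast
qed

text \<open>
A common limit of the two points can be moved into \<open>U\<close>, by minimality.
\<close>

lemma contract_pair:
  assumes min: "minimal G X \<alpha>" and prox: "proximal G X \<alpha>"
    and xy: "x \<in> topspace X" "y \<in> topspace X" and U: "openin X U" "U \<noteq> {}"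
  shows "\<exists>g\<in>carrier G. \<alpha> g x \<in> U \<and> \<alpha> g y \<in> U"
proof -
  obtain F z where F: "F \<noteq> bot" "F \<le> principal (carrier G)"
    "limitin X (\<lambda>g. \<alpha> g x) z F" "limitin X (\<lambda>g. \<alpha> g y) z F"
    using prox xy unfolding proximal_def by blast
  have z: "z \<in> topspace X" using F(3) limitin_topspace by metis
  obtain h where h: "h \<in> carrier G" "\<alpha> h z \<in> U" using minimal_orbit_meets[OF min z U] by blast
  let ?V = "{w \<in> topspace X. \<alpha> h w \<in> U}"
  have V: "openin X ?V" "z \<in> ?V" using openin_translate[OF h(1) U(1)] z h(2) by auto
  have "eventually (\<lambda>g. g \<in> carrier G) F" using F(2) by (simp add: le_principal)
  moreover have "eventually (\<lambda>g. \<alpha> g x \<in> ?V) F" "eventually (\<lambda>g. \<alpha> g y \<in> ?V) F"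
    using F(3,4) V unfolding limitin_def by blast+
  ultimately have "eventually (\<lambda>g. g \<in> carrier G \<and> \<alpha> g x \<in> ?V \<and> \<alpha> g y \<in> ?V) F"
    by eventually_elim blast
  then obtain g where g: "g \<in> carrier G" "\<alpha> g x \<in> ?V" "\<alpha> g y \<in> ?V"
    using eventually_happens'[OF F(1)] by blast
  then show ?thesis
    using act_mult[OF h(1) g(1)] xy mult_in[OF h(1) g(1)] by (intro bexI[of _ "h \<otimes> g"]) auto
qed

text \<open>
To add a point \<open>y\<close> to \<open>F\<close>, contract \<open>F\<close> towards some point \<open>z\<close>. By compactness the images of \<open>y\<close>
accumulate at a point \<open>w\<close> while \<open>F\<close> approaches \<open>z\<close>. An element \<open>h\<close> that moves \<open>z\<close> and \<open>w\<close> into \<open>U\<close>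
completes the contraction, because its preimage of \<open>U\<close> is a neighbourhood of both.
\<close>

lemma contract_finite:
  assumes min: "minimal G X \<alpha>" and prox: "proximal G X \<alpha>"
    and F: "finite F" "F \<subseteq> topspace X" and U: "openin X U" "U \<noteq> {}"
  shows "\<exists>g\<in>carrier G. \<forall>x\<in>F. \<alpha> g x \<in> U"
  using F U
proof (induction F arbitrary: U rule: finite_induct)
  case empty
  then show ?case using one_in by blast
next
  case (insert y F)
  obtain z where z: "z \<in> topspace X" using nonempty by blast
  \<comment> \<open>The positions of \<open>y\<close> under the elements that move \<open>F\<close> into the neighbourhood \<open>V\<close> of \<open>z\<close>.\<close>
  define W where "W V = {\<alpha> g y | g. g \<in> carrier G \<and> (\<forall>x\<in>F. \<alpha> g x \<in> V)}" for V
  let ?\<U> = "(\<lambda>V. X closure_of (W V)) ` {V. openin X V \<and> z \<in> V}"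
  have "\<Inter>?\<U> \<noteq> {}"
  proof (rule compact_space_fip[THEN iffD1, OF compact, rule_format], intro conjI ballI allI impI)
    show "closedin X C" if "C \<in> ?\<U>" for C using that by auto
    fix \<F> assume \<F>: "finite \<F> \<and> \<F> \<subseteq> ?\<U>"
    then obtain \<V> where \<V>: "finite \<V>" "\<V> \<subseteq> {V. openin X V \<and> z \<in> V}" "\<F> = (\<lambda>V. X closure_of (W V)) ` \<V>"
      using finite_subset_image[of \<F> "\<lambda>V. X closure_of (W V)" "{V. openin X V \<and> z \<in> V}"] by blast
    let ?V = "topspace X \<inter> \<Inter>\<V>"
    have "openin X ?V" using \<V> by (intro openin_Int_Inter) auto
    moreover have "z \<in> ?V" using \<V>(2) z by auto
    ultimately obtain g where g: "g \<in> carrier G" "\<forall>x\<in>F. \<alpha> g x \<in> ?V"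
      using insert.IH[of ?V] insert.prems(1) by auto
    have "\<alpha> g y \<in> X closure_of (W V)" if "V \<in> \<V>" for V
    proof -
      have "\<alpha> g y \<in> W V" using g that unfolding W_def by blast
      then show ?thesis
        using act_in[OF g(1)] insert.prems(1) by (auto simp: in_closure_of)
    qed
    then show "\<Inter>\<F> \<noteq> {}" using \<V>(3) by auto
  qed
  then obtain w where w: "\<And>V. openin X V \<Longrightarrow> z \<in> V \<Longrightarrow> w \<in> X closure_of (W V)" by auto
  have wX: "w \<in> topspace X" using w[of "topspace X"] z by (simp add: in_closure_of)
  obtain h where h: "h \<in> carrier G" "\<alpha> h z \<in> U" "\<alpha> h w \<in> U"
    using contract_pair[OF min prox z wX insert.prems(2,3)] by blast
  let ?V = "{x \<in> topspace X. \<alpha> h x \<in> U}"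
  have V: "openin X ?V" "z \<in> ?V" "w \<in> ?V"
    using openin_translate[OF h(1) insert.prems(2)] z wX h by auto
  obtain y' where "y' \<in> W ?V" "y' \<in> ?V"
    using w[OF V(1,2)] V(1,3) unfolding in_closure_of by meson
  then obtain g where g: "g \<in> carrier G" "\<forall>x\<in>F. \<alpha> g x \<in> ?V" "\<alpha> g y \<in> ?V"
    unfolding W_def by blast
  have "\<alpha> (h \<otimes> g) x \<in> U" if "x \<in> insert y F" for x
    using g that act_mult[OF h(1) g(1), of x] insert.prems(1) by auto
  then show ?case using mult_in[OF h(1) g(1)] by blast
qed

end

section \<open>Proximal flows under NIP\<close>

text \<open>
Markov's inequality read backwards: below the level \<open>\<epsilon> / 2\<close> the function contributes at most half of
its integral, and above it at most \<open>C\<close> times the measure of the superlevel set.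
\<close>

lemma measure_superlevel_ge:
  fixes f :: "'x \<Rightarrow> real"
  assumes "prob_space \<mu>" and f: "f \<in> borel_measurable \<mu>"
    and bound: "\<And>x. x \<in> space \<mu> \<Longrightarrow> 0 \<le> f x" "\<And>x. x \<in> space \<mu> \<Longrightarrow> f x \<le> C" and "0 < C"
    and int: "\<epsilon> \<le> (\<integral>x. f x \<partial>\<mu>)" and "0 < \<epsilon>"
  shows "\<epsilon> / (2 * C) \<le> measure \<mu> {x \<in> space \<mu>. \<epsilon> / 2 < f x}"
proof -
  interpret prob_space \<mu> by fact
  let ?A = "{x \<in> space \<mu>. \<epsilon> / 2 < f x}"
  have A: "?A \<in> sets \<mu>" using f by measurable
  have "\<epsilon> \<le> (\<integral>x. f x \<partial>\<mu>)" by fact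
  also have "\<dots> \<le> (\<integral>x. C * indicator ?A x + \<epsilon> / 2 \<partial>\<mu>)"
  proof (rule integral_mono)
    show "integrable \<mu> f"
      by (rule integrable_const_bound[of _ C]) (use bound f in auto)
    show "integrable \<mu> (\<lambda>x. C * indicator ?A x + \<epsilon> / 2)"
      using A by (intro Bochner_Integration.integrable_add integrable_mult_right
          integrable_real_indicator integrable_const) (auto simp: less_top[symmetric])
    show "f x \<le> C * indicator ?A x + \<epsilon> / 2" if "x \<in> space \<mu>" for x
      using bound(2)[OF that] that \<open>0 < \<epsilon>\<close> by (auto simp: indicator_def)
  qed
  also have "\<dots> = C * measure \<mu> ?A + \<epsilon> / 2"
    using A by (subst Bochner_Integration.integral_add)
      (auto simp: prob_space less_top[symmetric])
  finally show ?thesis using \<open>0 < C\<close> by (simp add: field_simps)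
qed

text \<open>
Otherwise \<open>\<integral>x. F (\<alpha> g x) \<partial>\<mu> \<ge> \<epsilon>\<close> for all \<open>g\<close>. Then each set where \<open>F (\<alpha> g x) > \<epsilon> / 2\<close> has measure
bounded below, while proximality gives, for every finite set, an element \<open>g\<close> that makes
\<open>F (\<alpha> g x) < \<epsilon> / 4\<close> on it. Definability of the orbit map of the one point \<open>z\<close>, whose orbit is dense,
yields a definable \<open>D\<close> that separates the two conditions along the orbit:
membership of \<open>g \<otimes> h\<close> in \<open>D\<close> decides on which side \<open>F (\<alpha> g (\<alpha> h z))\<close> lies. So the translates
of \<open>D\<close> would shatter sets of every finite size.
\<close>

proposition NIP_proximal_integral_small:
  fixes X :: "'x topology"
  assumes T: "complete_theory L T" "NIP_theory L T" and M: "is_model L T M"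
    and G: "definable_group L M n G"
    and X: "definable_flow L M n G X \<alpha>" "minimal G X \<alpha>" "proximal G X \<alpha>"
    and \<mu>: "\<mu> \<in> Prob X" and z: "z \<in> topspace X"
    and F: "continuous_map X euclideanreal F" "\<And>x. x \<in> topspace X \<Longrightarrow> 0 \<le> F x" "F z = 0"
    and \<epsilon>: "0 < \<epsilon>"
  shows "\<exists>g\<in>carrier G. (\<integral>x. F (\<alpha> g x) \<partial>\<mu>) < \<epsilon>"
proof (rule ccontr)
  assume "\<not> ?thesis"
  then have large: "\<epsilon> \<le> (\<integral>x. F (\<alpha> g x) \<partial>\<mu>)" if "g \<in> carrier G" for g
    using that by (auto simp: not_less)
  have "flow G X \<alpha>" using X(1) by (simp add: definable_flow_def)
  then interpret compact_flow G X \<alpha> by unfold_locales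
  interpret prob_space \<mu> using ProbD(1)[OF \<mu>] .
  note S = ProbD(2)[OF \<mu>] and sp = ProbD(3)[OF \<mu>]
  obtain C where C: "0 < C" "\<And>x. x \<in> topspace X \<Longrightarrow> \<bar>F x\<bar> \<le> C"
    using continuous_map_bounded[OF compact F(1)] by blast
  define A where "A g = {x \<in> topspace X. F (\<alpha> g x) \<in> {\<epsilon> / 2<..}}" for g
  define B where "B g = {x \<in> topspace X. F (\<alpha> g x) \<in> {..<\<epsilon> / 4}}" for g
  have cont: "continuous_map X euclideanreal (\<lambda>x. F (\<alpha> g x))" if "g \<in> carrier G" for g
    using continuous_map_compose[OF act_cont[OF that] F(1)] by (simp add: o_def)
  have opA: "openin X (A g)" and opB: "openin X (B g)" if "g \<in> carrier G" for g
    unfolding A_def B_def by (rule openin_continuous_map_preimage[OF cont[OF that]], simp)+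
  have muA: "\<epsilon> / (2 * C) \<le> measure \<mu> (A g)" if g: "g \<in> carrier G" for g
  proof -
    have "(\<lambda>x. F (\<alpha> g x)) \<in> borel_measurable \<mu>"
      using continuous_map_borel_measurable[OF cont[OF g]] measurable_cong_sets[OF S refl] by blast
    from measure_superlevel_ge[OF prob_space_axioms this _ _ C(1) large[OF g] \<epsilon>]
    have "\<epsilon> / (2 * C) \<le> measure \<mu> {x \<in> space \<mu>. \<epsilon> / 2 < F (\<alpha> g x)}"
      using F(2) C(2) act_in[OF g] sp by (simp add: abs_le_iff)
    then show ?thesis by (simp add: A_def sp)
  qed
  have evade: "\<exists>g\<in>carrier G. E \<subseteq> B g" if E: "finite E" "E \<subseteq> topspace X" for E
  proof -
    let ?U = "{x \<in> topspace X. F x \<in> {..<\<epsilon> / 4}}"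
    have "openin X ?U" by (rule openin_continuous_map_preimage[OF F(1)]) simp
    moreover have "?U \<noteq> {}" using z F(3) \<epsilon> by auto
    ultimately obtain g where "g \<in> carrier G" "\<forall>x\<in>E. \<alpha> g x \<in> ?U"
      using contract_finite[OF X(2,3) E] by blast
    then show ?thesis using E(2) unfolding B_def by (intro bexI[of _ g]) auto
  qed
  have dense: "\<exists>h\<in>carrier G. \<alpha> h z \<in> V" if "openin X V" "V \<noteq> {}" for V
    using minimal_orbit_meets[OF X(2) z that] .
  let ?C1 = "{x \<in> topspace X. F x \<in> {\<epsilon> / 2..}}" and ?C2 = "{x \<in> topspace X. F x \<in> {..\<epsilon> / 4}}"
  have "closedin X ?C1" "closedin X ?C2"
    by (rule closedin_continuous_map_preimage[OF F(1)], simp)+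
  moreover have "?C1 \<inter> ?C2 = {}" using \<epsilon> by auto
  ultimately obtain D where D: "D \<subseteq> carrier G" "definable_set L M n D"
     "separates D {g \<in> carrier G. \<alpha> g z \<in> ?C1} {g \<in> carrier G. \<alpha> g z \<in> ?C2}"
    using X(1) z unfolding definable_flow_def by blast
  obtain k where k: "\<And>U. U \<subseteq> carrier G \<Longrightarrow> finite U \<Longrightarrow> card U = k \<Longrightarrow>
      \<not> (\<forall>B \<subseteq> U. \<exists>g \<in> carrier G. \<forall>h \<in> U. g \<otimes>\<^bsub>G\<^esub> h \<in> D \<longleftrightarrow> h \<in> B)"
    using NIP_group_bounded_shattering[OF T M G D(2)] by blast
  have inC: "g \<otimes>\<^bsub>G\<^esub> h \<in> {g \<in> carrier G. \<alpha> g z \<in> ?C1}" if "\<alpha> h z \<in> A g" "g \<in> carrier G" "h \<in> carrier G" for g h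
    using that act_mult[OF that(2,3) z] mult_in[OF that(2,3)] act_in[OF mult_in[OF that(2,3)] z]
    unfolding A_def by auto
  have inC': "g \<otimes>\<^bsub>G\<^esub> h \<in> {g \<in> carrier G. \<alpha> g z \<in> ?C2}" if "\<alpha> h z \<in> B g" "g \<in> carrier G" "h \<in> carrier G" for g h
    using that act_mult[OF that(2,3) z] mult_in[OF that(2,3)] act_in[OF mult_in[OF that(2,3)] z]
    unfolding B_def by auto
  have pos: "0 < \<epsilon> / (2 * C)" using \<epsilon> C(1) by simp
  from D(3) consider
      "{g \<in> carrier G. \<alpha> g z \<in> ?C1} \<subseteq> D" "D \<inter> {g \<in> carrier G. \<alpha> g z \<in> ?C2} = {}"
    | "{g \<in> carrier G. \<alpha> g z \<in> ?C2} \<subseteq> D" "D \<inter> {g \<in> carrier G. \<alpha> g z \<in> ?C1} = {}"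
    unfolding separates_def by blast
  then show False
  proof cases
    case 1
    have "\<exists>U \<subseteq> carrier G. finite U \<and> card U = k \<and>
        traces_shatter ((\<lambda>g. {h \<in> carrier G. g \<otimes>\<^bsub>G\<^esub> h \<in> D}) ` carrier G) U"
      by (rule large_evading_family_shatters[where orb = "\<lambda>h. \<alpha> h z" and A = A and B = B,
            OF compact prob_space_axioms S opA opB muA pos evade dense])
         (use inC inC' 1 in blast)+
    then obtain U where U: "U \<subseteq> carrier G" "finite U" "card U = k"
      and sh: "\<And>B. B \<subseteq> U \<Longrightarrow> \<exists>g\<in>carrier G. {h \<in> carrier G. g \<otimes>\<^bsub>G\<^esub> h \<in> D} \<inter> U = B"
      unfolding traces_shatter_def by blast
    have "\<exists>g\<in>carrier G. \<forall>h\<in>U. g \<otimes>\<^bsub>G\<^esub> h \<in> D \<longleftrightarrow> h \<in> B" if B: "B \<subseteq> U" for B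
    proof -
      obtain g where "g \<in> carrier G" "{h \<in> carrier G. g \<otimes>\<^bsub>G\<^esub> h \<in> D} \<inter> U = B"
        using sh[OF B] by blast
      then show ?thesis using U(1) by (intro bexI[of _ g]) auto
    qed
    then show False using k[OF U] by blast
  next
    \<comment> \<open>Here \<open>D\<close> contains the small values, and its complement is shattered in place of \<open>D\<close>.\<close>
    case 2
    have "\<exists>U \<subseteq> carrier G. finite U \<and> card U = k \<and>
        traces_shatter ((\<lambda>g. {h \<in> carrier G. g \<otimes>\<^bsub>G\<^esub> h \<notin> D}) ` carrier G) U"
      by (rule large_evading_family_shatters[where orb = "\<lambda>h. \<alpha> h z" and A = A and B = B,
            OF compact prob_space_axioms S opA opB muA pos evade dense])
         (use inC inC' 2 in blast)+
    then obtain U where U: "U \<subseteq> carrier G" "finite U" "card U = k"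
      and sh: "\<And>B. B \<subseteq> U \<Longrightarrow> \<exists>g\<in>carrier G. {h \<in> carrier G. g \<otimes>\<^bsub>G\<^esub> h \<notin> D} \<inter> U = B"
      unfolding traces_shatter_def by blast
    have "\<exists>g\<in>carrier G. \<forall>h\<in>U. g \<otimes>\<^bsub>G\<^esub> h \<in> D \<longleftrightarrow> h \<in> B" if B: "B \<subseteq> U" for B
    proof -
      obtain g where "g \<in> carrier G" "{h \<in> carrier G. g \<otimes>\<^bsub>G\<^esub> h \<notin> D} \<inter> U = U - B"
        using sh[of "U - B"] by blast
      then show ?thesis using U(1) B by (intro bexI[of _ g]) auto
    qed
    then show False using k[OF U] by blast
  qed
qed

text \<open>
Every orbit of measures accumulates at every Dirac measure, so any point \<open>z\<close> will do.
\<close>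

theorem NIP_minimal_proximal_imp_strongly_proximal:
  assumes "complete_theory L T" "NIP_theory L T" "is_model L T M" "definable_group L M n G"
    and X: "definable_flow L M n G X \<alpha>" "minimal G X \<alpha>" "proximal G X \<alpha>"
  shows "strongly_proximal G X \<alpha>"
  unfolding strongly_proximal_def
proof
  fix \<mu> assume \<mu>: "\<mu> \<in> Prob X"
  have "flow G X \<alpha>" using X(1) by (simp add: definable_flow_def)
  then interpret compact_flow G X \<alpha> by unfold_locales
  obtain z where z: "z \<in> topspace X" using nonempty by blast
  have "return (borel_measure_of X) z
    \<in> weak_star X closure_of ((\<lambda>g. distr \<mu> (borel_measure_of X) (\<alpha> g)) ` carrier G)"
    using NIP_proximal_integral_small[OF assms \<mu> z]
    by (intro return_in_closure_of_orbit[OF compact hausdorff homeo \<mu> z]) auto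
  then show "\<exists>x\<in>topspace X. return (borel_measure_of X) x
    \<in> weak_star X closure_of ((\<lambda>g. distr \<mu> (borel_measure_of X) (\<alpha> g)) ` carrier G)"
    using z by blast
qed

section \<open>Universal flows\<close>

lemma limitin_continuous_image:
  assumes "limitin X f l F" "continuous_map X Y h" "\<And>a. a \<in> S \<Longrightarrow> f a \<in> topspace X" "F \<le> principal S"
    and eq: "\<And>a. a \<in> S \<Longrightarrow> k a = h (f a)"
  shows "limitin Y k (h l) F"
  unfolding limitin_def
proof (intro conjI allI impI)
  show "h l \<in> topspace Y"
    using assms(1,2) limitin_topspace continuous_map_image_subset_topspace by fastforce
  fix V assume V: "openin Y V \<and> h l \<in> V"
  have "openin X {x \<in> topspace X. h x \<in> V}"
    using assms(2) V openin_continuous_map_preimage by blast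
  moreover have "l \<in> {x \<in> topspace X. h x \<in> V}" using assms(1) V limitin_topspace by fastforce
  ultimately have "eventually (\<lambda>a. f a \<in> {x \<in> topspace X. h x \<in> V}) F"
    using assms(1) unfolding limitin_def by blast
  moreover have "eventually (\<lambda>a. a \<in> S) F" using assms(4) by (simp add: le_principal)
  ultimately show "eventually (\<lambda>a. k a \<in> V) F" by eventually_elim (auto simp: eq)
qed

text \<open>
Apply strong proximality to the measure with mass \<open>1 / 2\<close> at \<open>x\<close> and at \<open>y\<close>. If its image is close to
the Dirac measure at \<open>w\<close>, neither half can be far away: for an open \<open>U\<close> around \<open>w\<close> take a continuous
\<open>f\<close> from \<open>X\<close> to \<open>[0, 1]\<close> that is \<open>0\<close> at \<open>w\<close> and \<open>1\<close> outside of \<open>U\<close>; as soon as the integral of \<open>f\<close> is below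
\<open>1 / 2\<close>, both points have been moved into \<open>U\<close>.
\<close>

lemma strongly_proximal_imp_proximal:
  fixes X :: "'x topology"
  assumes "flow G X \<alpha>" and sp: "strongly_proximal G X \<alpha>"
  shows "proximal G X \<alpha>"
  unfolding proximal_def
proof (intro ballI)
  interpret compact_flow G X \<alpha> by unfold_locales fact
  fix x y assume xy: "x \<in> topspace X" "y \<in> topspace X"
  define s where "s b = (if b then x else y)" for b
  let ?N = "borel_measure_of X"
  define \<mu> where "\<mu> = distr (bernoulli_pmf (1 / 2)) ?N s"
  have s: "s \<in> measurable (bernoulli_pmf (1 / 2)) ?N" using xy by (simp add: s_def)
  have xyN: "{x, y} \<in> sets ?N"
    using closedin_Hausdorff_finite[OF hausdorff, of "{x, y}"] xy sets_borel_measure_of_closed by auto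
  have "{z \<in> topspace X. z \<in> {x, y}} = {x, y}" using xy by auto
  then have "AE z in \<mu>. z \<in> {x, y}"
    unfolding \<mu>_def using xyN s by (subst AE_distr_iff) (auto simp: s_def)
  then have "\<mu> \<in> Prob X"
    using xy measure_pmf.prob_space_distr[OF s]
    by (intro finitely_supported_in_Prob[OF hausdorff, of _ "{x, y}"]) (auto simp: \<mu>_def)
  then obtain w where w: "w \<in> topspace X"
    "return ?N w \<in> weak_star X closure_of ((\<lambda>g. distr \<mu> ?N (\<alpha> g)) ` carrier G)"
    using sp unfolding strongly_proximal_def by blast
  define S where "S U = {g \<in> carrier G. \<alpha> g x \<in> U \<and> \<alpha> g y \<in> U}" for U
  have S_ne: "S U \<noteq> {}" if U: "openin X U" "w \<in> U" for U
  proof -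
    have "completely_regular_space X"
      by (intro normal_imp_completely_regular_space compact_Hausdorff_or_regular_imp_normal_space)
         (auto simp: compact hausdorff)
    moreover have "closedin X (topspace X - U)" "w \<in> topspace X - (topspace X - U)"
      using U w(1) by auto
    ultimately obtain f :: "'x \<Rightarrow> real" where f: "continuous_map X (top_of_set {0..1}) f" "f w = 0"
      "f ` (topspace X - U) \<subseteq> {1}" unfolding completely_regular_space_def by blast
    have fc: "continuous_map X euclideanreal f" and f01: "\<And>z. z \<in> topspace X \<Longrightarrow> f z \<in> {0..1}"
      using f(1) by (auto simp: continuous_map_in_subtopology)
    have fm: "f \<in> borel_measurable ?N" using fc by (rule continuous_map_borel_measurable)
    have fC: "f \<in> cont_funs X" using fc by (simp add: cont_funs_def)
    let ?P = "product_topology (\<lambda>_. euclideanreal) (cont_funs X)"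
    let ?O = "{\<phi> \<in> topspace ?P. \<phi> f \<in> {..<1 / 2}}"
    let ?W = "(\<lambda>\<mu>. \<lambda>f \<in> cont_funs X. integral\<^sup>L \<mu> f) -` ?O \<inter> Prob X"
    have "openin ?P ?O"
      by (rule openin_continuous_map_preimage[OF continuous_map_product_projection[OF fC]]) simp
    then have "openin (weak_star X) ?W" unfolding weak_star_def openin_pullback_topology by blast
    moreover have ret: "integral\<^sup>L (return ?N w) f = 0" using w(1) fm f(2) by (subst integral_return) auto
    have "return ?N w \<in> ?W" using return_in_Prob[OF hausdorff w(1)] fC ret by auto
    ultimately have "\<exists>\<nu>. \<nu> \<in> (\<lambda>g. distr \<mu> ?N (\<alpha> g)) ` carrier G \<and> \<nu> \<in> ?W"
      by (intro w(2)[unfolded in_closure_of, THEN conjunct2, rule_format] conjI)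
    then obtain g where g: "g \<in> carrier G" "distr \<mu> ?N (\<alpha> g) \<in> ?W" by blast
    then have "integral\<^sup>L (distr \<mu> ?N (\<alpha> g)) f < 1 / 2" using fC by simp
    moreover have am: "\<alpha> g \<in> measurable ?N ?N"
      using continuous_map_measurable_borel_measure_of[OF act_cont[OF g(1)]] .
    have "integral\<^sup>L (distr \<mu> ?N (\<alpha> g)) f = (\<integral>b. f (\<alpha> g (s b)) \<partial>bernoulli_pmf (1 / 2))"
    proof -
      have "\<alpha> g \<in> measurable \<mu> ?N" using am by (simp add: \<mu>_def)
      then have "integral\<^sup>L (distr \<mu> ?N (\<alpha> g)) f = (\<integral>z. f (\<alpha> g z) \<partial>\<mu>)" using fm by (rule integral_distr)
      also have "\<dots> = (\<integral>b. f (\<alpha> g (s b)) \<partial>bernoulli_pmf (1 / 2))"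
        unfolding \<mu>_def using s measurable_compose[OF am fm] by (rule integral_distr)
      finally show ?thesis .
    qed
    ultimately have "f (\<alpha> g x) + f (\<alpha> g y) < 1" by (simp add: s_def)
    then have "f (\<alpha> g x) \<noteq> 1" "f (\<alpha> g y) \<noteq> 1"
      using f01[OF act_in[OF g(1) xy(1)]] f01[OF act_in[OF g(1) xy(2)]] by auto
    then have "g \<in> S U" using f(3) act_in[OF g(1)] xy g(1) by (auto simp: S_def)
    then show ?thesis by blast
  qed
  define F where "F = (INF U \<in> {U. openin X U \<and> w \<in> U}. principal (S U))"
  have "F \<noteq> bot"
    unfolding F_def
  proof (rule INF_filter_not_bot)
    fix \<V> assume \<V>: "\<V> \<subseteq> {U. openin X U \<and> w \<in> U}" "finite \<V>"
    let ?U = "topspace X \<inter> \<Inter>\<V>"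
    have "openin X ?U" using \<V> by (intro openin_Int_Inter) auto
    moreover have "w \<in> ?U" using \<V>(1) w(1) by auto
    ultimately have "S ?U \<noteq> {}" by (rule S_ne)
    moreover have "S ?U \<subseteq> (\<Inter>V\<in>\<V>. S V)" by (auto simp: S_def)
    ultimately show "(INF V\<in>\<V>. principal (S V)) \<noteq> bot"
      unfolding INF_principal_finite[OF \<V>(2)] by (auto simp: principal_eq_bot_iff)
  qed
  moreover have le: "F \<le> principal (S U)" if "openin X U" "w \<in> U" for U
    unfolding F_def using that by (intro INF_lower) auto
  have "S (topspace X) \<subseteq> carrier G" by (auto simp: S_def)
  then have "F \<le> principal (carrier G)"
    using le[OF openin_topspace w(1)] by (meson order_trans principal_le_iff)
  moreover have "limitin X (\<lambda>g. \<alpha> g x) w F" "limitin X (\<lambda>g. \<alpha> g y) w F"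
    using w(1) le unfolding limitin_def S_def le_principal
    by (auto elim!: eventually_mono[rotated] intro: eventually_mono)
  ultimately show "\<exists>F z. F \<noteq> bot \<and> F \<le> principal (carrier G) \<and>
      limitin X (\<lambda>g. \<alpha> g x) z F \<and> limitin X (\<lambda>g. \<alpha> g y) z F" by blast
qed

text \<open>
The restriction makes the result extensional, as the permutation group \<^const>\<open>BijGroup\<close> demands.
\<close>

definition transport_action ::
  "('g \<Rightarrow> 'x \<Rightarrow> 'x) \<Rightarrow> 'y topology \<Rightarrow> ('x \<Rightarrow> 'y) \<Rightarrow> ('y \<Rightarrow> 'x) \<Rightarrow> 'g \<Rightarrow> 'y \<Rightarrow> 'y" where
  "transport_action \<alpha> Y i j g = restrict (\<lambda>y. i (\<alpha> g (j y))) (topspace Y)"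

context compact_flow begin

context
  fixes Y :: "'y topology" and i :: "'x \<Rightarrow> 'y" and j :: "'y \<Rightarrow> 'x"
  assumes ij: "homeomorphic_maps X Y i j"
begin

abbreviation "\<beta> \<equiv> transport_action \<alpha> Y i j"

lemma transport_basics:
  shows "continuous_map X Y i" "continuous_map Y X j"
    and "\<And>x. x \<in> topspace X \<Longrightarrow> j (i x) = x" "\<And>y. y \<in> topspace Y \<Longrightarrow> i (j y) = y"
    and "\<And>x. x \<in> topspace X \<Longrightarrow> i x \<in> topspace Y" "\<And>y. y \<in> topspace Y \<Longrightarrow> j y \<in> topspace X"
  using ij by (auto simp: homeomorphic_maps_def continuous_map_def)

lemma transport_apply: "y \<in> topspace Y \<Longrightarrow> \<beta> g y = i (\<alpha> g (j y))"
  by (simp add: transport_action_def)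

lemma transport_flow: "flow G Y \<beta>"
proof -
  note tb = transport_basics
  have ne: "topspace Y \<noteq> {}" using nonempty tb(5) by blast
  have hs: "X homeomorphic_space Y" using ij by (auto simp: homeomorphic_space_def)
  have comp: "compact_space Y" "Hausdorff_space Y"
    using homeomorphic_compact_space[OF hs] homeomorphic_Hausdorff_space[OF hs] compact hausdorff by auto
  have hom: "homeomorphic_map Y Y (\<beta> g)" if g: "g \<in> carrier G" for g
  proof -
    have "homeomorphic_map X Y i" "homeomorphic_map Y X j"
      using ij by (auto simp: homeomorphic_maps_map)
    then have "homeomorphic_map Y Y (i \<circ> (\<alpha> g \<circ> j))"
      using homeo[OF g] by (intro homeomorphic_map_compose)
    then show ?thesis
      by (rule homeomorphic_map_eq) (simp add: transport_apply)
  qed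
  have bij: "\<beta> g \<in> carrier (BijGroup (topspace Y))" if "g \<in> carrier G" for g
  proof -
    have "bij_betw (\<beta> g) (topspace Y) (topspace Y)"
      using homeomorphic_imp_injective_map[OF hom[OF that]] homeomorphic_imp_surjective_map[OF hom[OF that]]
      by (simp add: bij_betw_def)
    moreover have "\<beta> g \<in> extensional (topspace Y)" by (simp add: transport_action_def)
    ultimately show ?thesis by (simp add: BijGroup_def Bij_def)
  qed
  have "\<beta> (g \<otimes> h) = \<beta> g \<otimes>\<^bsub>BijGroup (topspace Y)\<^esub> \<beta> h" if gh: "g \<in> carrier G" "h \<in> carrier G" for g h
  proof -
    have "\<beta> g \<otimes>\<^bsub>BijGroup (topspace Y)\<^esub> \<beta> h = compose (topspace Y) (\<beta> g) (\<beta> h)"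
      using bij[OF gh(1)] bij[OF gh(2)] by (simp add: BijGroup_def)
    also have "\<dots> = \<beta> (g \<otimes> h)"
    proof
      fix y
      show "compose (topspace Y) (\<beta> g) (\<beta> h) y = \<beta> (g \<otimes> h) y"
      proof (cases "y \<in> topspace Y")
        case True
        then have "\<alpha> h (j y) \<in> topspace X" using act_in[OF gh(2)] tb(6) by blast
        then show ?thesis
          using True tb(3,5,6) act_mult[OF gh] by (simp add: compose_eq transport_apply)
      next
        case False
        then show ?thesis by (simp add: compose_def transport_action_def)
      qed
    qed
    finally show ?thesis by simp
  qed
  then have "\<beta> \<in> hom G (BijGroup (topspace Y))"
    using bij by (auto simp: hom_def)
  then have "group_action G (topspace Y) \<beta>"
    unfolding group_action_def group_hom_def group_hom_axioms_def using grp group_BijGroup by blast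
  then show ?thesis using ne comp hom by (simp add: flow_def)
qed

lemma transport_minimal:
  assumes "minimal G X \<alpha>"
  shows "minimal G Y \<beta>"
  unfolding minimal_def
proof (intro allI impI)
  note tb = transport_basics
  fix Z assume Z: "subflow G Y \<beta> Z \<and> Z \<noteq> {}"
  then have ZY: "Z \<subseteq> topspace Y" "closedin Y Z" by (auto simp: subflow_def closedin_def)
  let ?Z = "{x \<in> topspace X. i x \<in> Z}"
  have "closedin X ?Z" using closedin_continuous_map_preimage[OF tb(1) ZY(2)] .
  moreover have "\<alpha> g x \<in> ?Z" if "g \<in> carrier G" "x \<in> ?Z" for g x
  proof -
    have x: "x \<in> topspace X" "i x \<in> Z" using that(2) by auto
    then have "\<beta> g (i x) \<in> Z" using Z that(1) by (auto simp: subflow_def)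
    then show ?thesis using x that(1) tb(3,5) act_in by (simp add: transport_apply)
  qed
  moreover have "?Z \<noteq> {}" using Z ZY(1) tb(4,6) by fastforce
  ultimately have "?Z = topspace X" using assms by (auto simp: minimal_def subflow_def)
  then show "Z = topspace Y" using ZY(1) tb(4,6) by (metis (no_types, lifting) mem_Collect_eq subsetI subset_antisym)
qed

lemma transport_proximal:
  assumes "proximal G X \<alpha>"
  shows "proximal G Y \<beta>"
  unfolding proximal_def
proof (intro ballI)
  note tb = transport_basics
  fix y y' assume y: "y \<in> topspace Y" "y' \<in> topspace Y"
  then obtain F z where F: "F \<noteq> bot" "F \<le> principal (carrier G)"
      "limitin X (\<lambda>g. \<alpha> g (j y)) z F" "limitin X (\<lambda>g. \<alpha> g (j y')) z F"
    using assms tb(6) unfolding proximal_def by blast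
  have "limitin Y (\<lambda>g. \<beta> g y) (i z) F"
    using y tb(6) act_in by (intro limitin_continuous_image[OF F(3) tb(1) _ F(2)]) (auto simp: transport_apply)
  moreover have "limitin Y (\<lambda>g. \<beta> g y') (i z) F"
    using y tb(6) act_in by (intro limitin_continuous_image[OF F(4) tb(1) _ F(2)]) (auto simp: transport_apply)
  ultimately show "\<exists>F z. F \<noteq> bot \<and> F \<le> principal (carrier G) \<and>
      limitin Y (\<lambda>g. \<beta> g y) z F \<and> limitin Y (\<lambda>g. \<beta> g y') z F" using F(1,2) by blast
qed

lemma transport_equivariant: "equivariant G Y \<beta> \<alpha> j"
  using transport_basics act_in by (auto simp: equivariant_def transport_apply)

end

text \<open>
A point is determined by the subsets of the orbit of \<open>x0\<close> that accumulate at it. This makes every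
minimal flow isomorphic to one in the type over which universality is tested.
\<close>

lemma minimal_flow_embeds:
  assumes min: "minimal G X \<alpha>" and x0: "x0 \<in> topspace X"
  shows "inj_on (\<lambda>x. {A. A \<subseteq> carrier G \<and> x \<in> X closure_of ((\<lambda>g. \<alpha> g x0) ` A)}) (topspace X)"
proof (rule inj_onI, rule ccontr)
  let ?\<iota> = "\<lambda>x. {A. A \<subseteq> carrier G \<and> x \<in> X closure_of ((\<lambda>g. \<alpha> g x0) ` A)}"
  fix x y assume xy: "x \<in> topspace X" "y \<in> topspace X" "?\<iota> x = ?\<iota> y" "x \<noteq> y"
  obtain U V where UV: "openin X U" "openin X V" "x \<in> U" "y \<in> V" "disjnt U V"
    using hausdorff xy(1,2,4) unfolding Hausdorff_space_def by metis
  let ?A = "{g \<in> carrier G. \<alpha> g x0 \<in> U}"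
  have "x \<in> X closure_of ((\<lambda>g. \<alpha> g x0) ` ?A)"
    unfolding in_closure_of
  proof (intro conjI allI impI xy(1))
    fix T assume T: "x \<in> T \<and> openin X T"
    then have "openin X (T \<inter> U)" "T \<inter> U \<noteq> {}" using UV by auto
    from minimal_orbit_meets[OF min x0 this]
    show "\<exists>z. z \<in> (\<lambda>g. \<alpha> g x0) ` ?A \<and> z \<in> T" by blast
  qed
  then have "?A \<in> ?\<iota> x" by blast
  then have "y \<in> X closure_of ((\<lambda>g. \<alpha> g x0) ` ?A)" using xy(3) by blast
  then have "\<exists>z. z \<in> (\<lambda>g. \<alpha> g x0) ` ?A \<and> z \<in> V" using UV(2,4) unfolding in_closure_of by blast
  then show False using UV(5) unfolding disjnt_def by blast
qed

text \<open>
Move \<open>x\<close> and \<open>h x\<close> towards a common limit \<open>w\<close>. Then \<open>h w = w\<close>, and the fixed points of \<open>h\<close> form a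
subflow, which is everything by minimality.
\<close>

lemma endomorphism_eq_id:
  assumes min: "minimal G X \<alpha>" and prox: "proximal G X \<alpha>"
    and h: "continuous_map X X h" "equivariant G X \<alpha> \<alpha> h" and x: "x \<in> topspace X"
  shows "h x = x"
proof -
  have hX: "h y \<in> topspace X" if "y \<in> topspace X" for y
    using h(1) that by (auto simp: continuous_map_def)
  let ?E = "{y \<in> topspace X. h y = y}"
  have "closedin X ?E"
    using closedin_continuous_maps_eq[OF hausdorff h(1) continuous_map_id] by simp
  then have "subflow G X \<alpha> ?E"
    using h(2) act_in by (auto simp: subflow_def equivariant_def)
  moreover have "?E \<noteq> {}"
  proof -
    obtain F w where F: "F \<noteq> bot" "F \<le> principal (carrier G)"
      "limitin X (\<lambda>g. \<alpha> g x) w F" "limitin X (\<lambda>g. \<alpha> g (h x)) w F"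
      using prox x hX[OF x] unfolding proximal_def by blast
    have "limitin X (\<lambda>g. \<alpha> g (h x)) (h w) F"
      using h(2) x act_in by (intro limitin_continuous_image[OF F(3) h(1) _ F(2)])
        (auto simp: equivariant_def)
    then have "h w = w" using limitin_Hausdorff_unique[OF _ F(4) F(1) hausdorff] by blast
    then show ?thesis using limitin_topspace[OF F(3)] by blast
  qed
  ultimately have "?E = topspace X" using min by (simp add: minimal_def)
  then show ?thesis using x by blast
qed

end

lemma homeomorphic_maps_onto_inj_image:
  assumes "inj_on \<iota> (topspace X)"
  shows "\<exists>Y. homeomorphic_maps X Y \<iota> (inv_into (topspace X) \<iota>)"
proof
  let ?j = "inv_into (topspace X) \<iota>"
  let ?Y = "pullback_topology (\<iota> ` topspace X) ?j X"
  have j: "?j (\<iota> x) = x" if "x \<in> topspace X" for x using assms that by simp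
  have "topspace ?Y = \<iota> ` topspace X"
    unfolding topspace_pullback_topology using j by auto
  moreover have "continuous_map ?Y X ?j"
    using continuous_map_pullback[OF continuous_map_id, of "\<iota> ` topspace X" ?j X] by simp
  moreover have "continuous_map X ?Y \<iota>"
  proof (rule continuous_map_pullback')
    show "continuous_map X X (?j \<circ> \<iota>)"
      by (rule continuous_map_eq[OF continuous_map_id]) (simp add: j)
  qed auto
  ultimately show "homeomorphic_maps X ?Y \<iota> ?j"
    using j by (auto simp: homeomorphic_maps_def)
qed

lemma transport_definable_flow:
  assumes ij: "homeomorphic_maps X Y i j" and X: "definable_flow L M n G X \<alpha>"
  shows "definable_flow L M n G Y (transport_action \<alpha> Y i j)"
proof -
  have "flow G X \<alpha>" using X by (simp add: definable_flow_def)
  then interpret compact_flow G X \<alpha> by unfold_locales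
  note tb = transport_basics[OF ij]
  have "\<exists>D \<subseteq> carrier G. definable_set L M n D \<and> separates D
      {g \<in> carrier G. transport_action \<alpha> Y i j g y \<in> C1} {g \<in> carrier G. transport_action \<alpha> Y i j g y \<in> C2}"
    if y: "y \<in> topspace Y" and C: "closedin Y C1" "closedin Y C2" "C1 \<inter> C2 = {}" for y C1 C2
  proof -
    let ?pre = "\<lambda>C. {x \<in> topspace X. i x \<in> C}"
    have "closedin X (?pre C1)" "closedin X (?pre C2)" "?pre C1 \<inter> ?pre C2 = {}"
      using closedin_continuous_map_preimage[OF tb(1)] C by auto
    then have "\<exists>D \<subseteq> carrier G. definable_set L M n D \<and>
        separates D {g \<in> carrier G. \<alpha> g (j y) \<in> ?pre C1} {g \<in> carrier G. \<alpha> g (j y) \<in> ?pre C2}"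
      using X tb(6)[OF y] unfolding definable_flow_def by blast
    moreover have "{g \<in> carrier G. \<alpha> g (j y) \<in> ?pre C} = {g \<in> carrier G. transport_action \<alpha> Y i j g y \<in> C}" for C
      using y tb(6) act_in by (auto simp: transport_apply[OF ij])
    ultimately show ?thesis by simp
  qed
  then show ?thesis using transport_flow[OF ij] unfolding definable_flow_def by blast
qed

lemma universal_maps_to_min_prox_def_flow:
  fixes S :: "'y topology" and G :: "'a list monoid"
  assumes univ: "universal_min_prox_def_flow L M n G P \<alpha>" and S: "min_prox_def_flow L M n G S \<sigma>"
  shows "\<exists>h. continuous_map P S h \<and> equivariant G P \<alpha> \<sigma> h"
proof -
  have "flow G S \<sigma>" and mp: "minimal G S \<sigma>" "proximal G S \<sigma>" and def: "definable_flow L M n G S \<sigma>"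
    using S by (simp_all add: min_prox_def_flow_def definable_flow_def)
  then interpret S: compact_flow G S \<sigma> by unfold_locales
  obtain s0 where "s0 \<in> topspace S" using S.nonempty by blast
  from homeomorphic_maps_onto_inj_image[OF S.minimal_flow_embeds[OF mp(1) this]]
  obtain Y :: "'a list set set topology" and i j where ij: "homeomorphic_maps S Y i j" by blast
  let ?\<beta> = "transport_action \<sigma> Y i j"
  have "min_prox_def_flow L M n G Y ?\<beta>"
    unfolding min_prox_def_flow_def
    using transport_definable_flow[OF ij def] S.transport_minimal[OF ij mp(1)] S.transport_proximal[OF ij mp(2)]
    by blast
  then obtain h where h: "continuous_map P Y h" "equivariant G P \<alpha> ?\<beta> h"
    using univ unfolding universal_min_prox_def_flow_def maps_onto_def by blast
  have "continuous_map P S (j \<circ> h)"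
    using h(1) S.transport_basics(2)[OF ij] by (rule continuous_map_compose)
  moreover have "h p \<in> topspace Y" if "p \<in> topspace P" for p
    using h(1) that by (auto simp: continuous_map_def)
  then have "equivariant G P \<alpha> \<sigma> (j \<circ> h)"
    using h(2) S.transport_equivariant[OF ij] by (simp add: equivariant_def)
  ultimately show ?thesis by blast
qed

text \<open>
The two flows map onto each other, and both composites are the identity because a minimal proximal
flow has no other endomorphism.
\<close>

lemma universal_min_prox_def_flow_unique:
  fixes P :: "'x topology" and S :: "'y topology" and G :: "'a list monoid"
  assumes P: "universal_min_prox_def_flow L M n G P \<alpha>" and S: "universal_min_prox_def_flow L M n G S \<sigma>"
  shows "flow_iso G P \<alpha> S \<sigma>"
proof -
  have mP: "min_prox_def_flow L M n G P \<alpha>" and mS: "min_prox_def_flow L M n G S \<sigma>"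
    using P S by (simp_all add: universal_min_prox_def_flow_def)
  obtain h where h: "continuous_map P S h" "equivariant G P \<alpha> \<sigma> h"
    using universal_maps_to_min_prox_def_flow[OF P mS] by blast
  obtain k where k: "continuous_map S P k" "equivariant G S \<sigma> \<alpha> k"
    using universal_maps_to_min_prox_def_flow[OF S mP] by blast
  have hS: "h p \<in> topspace S" if "p \<in> topspace P" for p
    using h(1) that by (auto simp: continuous_map_def)
  have kP: "k s \<in> topspace P" if "s \<in> topspace S" for s
    using k(1) that by (auto simp: continuous_map_def)
  have fl: "flow G P \<alpha>" "minimal G P \<alpha>" "proximal G P \<alpha>" "flow G S \<sigma>" "minimal G S \<sigma>" "proximal G S \<sigma>"
    using mP mS by (simp_all add: min_prox_def_flow_def definable_flow_def)
  interpret P: compact_flow G P \<alpha> by unfold_locales (fact fl)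
  interpret S: compact_flow G S \<sigma> by unfold_locales (fact fl)
  have "(k \<circ> h) p = p" if "p \<in> topspace P" for p
  proof (rule P.endomorphism_eq_id[OF fl(2,3) continuous_map_compose[OF h(1) k(1)] _ that])
    show "equivariant G P \<alpha> \<alpha> (k \<circ> h)"
      using h(2) k(2) hS by (simp add: equivariant_def)
  qed
  moreover have "(h \<circ> k) s = s" if "s \<in> topspace S" for s
  proof (rule S.endomorphism_eq_id[OF fl(5,6) continuous_map_compose[OF k(1) h(1)] _ that])
    show "equivariant G S \<sigma> \<sigma> (h \<circ> k)"
      using h(2) k(2) kP by (simp add: equivariant_def)
  qed
  ultimately have "homeomorphic_maps P S h k"
    using h(1) k(1) by (simp add: homeomorphic_maps_def)
  then show ?thesis
    unfolding flow_iso_def using h(2) homeomorphic_map_maps by blast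
qed

lemma NIP_min_prox_def_flow_iff:
  assumes "complete_theory L T" "NIP_theory L T" "is_model L T M" "definable_group L M n G"
  shows "min_prox_def_flow L M n G X \<alpha> \<longleftrightarrow> min_sprox_def_flow L M n G X \<alpha>"
  unfolding min_prox_def_flow_def min_sprox_def_flow_def
  using NIP_minimal_proximal_imp_strongly_proximal[OF assms] strongly_proximal_imp_proximal[of G X \<alpha>]
  by (auto simp: definable_flow_def)

lemma NIP_universal_min_prox_def_flow_iff:
  assumes "complete_theory L T" "NIP_theory L T" "is_model L T M" "definable_group L M n G"
  shows "universal_min_prox_def_flow L M n G P \<alpha> \<longleftrightarrow> universal_min_sprox_def_flow L M n G P \<alpha>"
  unfolding universal_min_prox_def_flow_def universal_min_sprox_def_flow_def
  by (simp only: NIP_min_prox_def_flow_iff[OF assms])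

theorem theorem1:
  fixes L :: "('f, 'r) language"
    and T :: "('f, 'r) fm set"
    and M :: "('f, 'r, 'a) fo_structure"
    and n :: nat
    and G :: "'a list monoid"
  assumes "complete_theory L T"
    and "NIP_theory L T"
    and "is_model L T M"
    and "definable_group L M n G"
  shows "(\<forall>(X :: 'x topology) \<alpha>.
            definable_flow L M n G X \<alpha> \<and> minimal G X \<alpha> \<and> proximal G X \<alpha> \<longrightarrow>
            strongly_proximal G X \<alpha>) \<and>
         (\<forall>(P :: 'x topology) \<alpha>.
            universal_min_prox_def_flow L M n G P \<alpha> \<longleftrightarrow>
            universal_min_sprox_def_flow L M n G P \<alpha>) \<and>
         (\<forall>(P :: 'x topology) \<alpha> (S :: 'y topology) \<beta>.
            universal_min_prox_def_flow L M n G P \<alpha> \<and>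
            universal_min_sprox_def_flow L M n G S \<beta> \<longrightarrow>
            flow_iso G P \<alpha> S \<beta>)"
proof (intro conjI allI impI)
  fix X :: "'x topology" and \<alpha>
  assume "definable_flow L M n G X \<alpha> \<and> minimal G X \<alpha> \<and> proximal G X \<alpha>"
  then show "strongly_proximal G X \<alpha>"
    by (intro NIP_minimal_proximal_imp_strongly_proximal[OF assms]) simp_all
next
  fix P :: "'x topology" and \<alpha>
  show "universal_min_prox_def_flow L M n G P \<alpha> \<longleftrightarrow> universal_min_sprox_def_flow L M n G P \<alpha>"
    by (rule NIP_universal_min_prox_def_flow_iff[OF assms])
next
  fix P :: "'x topology" and \<alpha> and S :: "'y topology" and \<beta>
  assume "universal_min_prox_def_flow L M n G P \<alpha> \<and> universal_min_sprox_def_flow L M n G S \<beta>"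
  then show "flow_iso G P \<alpha> S \<beta>"
    using NIP_universal_min_prox_def_flow_iff[OF assms] universal_min_prox_def_flow_unique by metis
qed

end
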